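(* Let $\mathrm{G}$ be any metric space on the $C \ge 2$ packet colors, let $L \ge 1$ be the minimal laxity, and let $\delta = \mathrm{MST}(\mathrm{G})/L$. If $\delta < 1$, then no deterministic or randomized online algorithm can achieve a competitive ratio better than $1 - \Omega(\sqrt{\delta})$ for the colored packet scheduling problem with transition costs given by $\mathrm{G}$. If $\delta \ge 1$, then no deterministic or randomized online algorithm can achieve a competitive ratio better than $\alpha$, for some constant $\alpha < 1$.
   Context: Colored packet scheduling with transition costs: there are $C$ colors, and transition costs $w(j,k) \ge 0$ for colors $j \ne k$, with $w(j,j)=0$; here $w$ is a metric on the set of colors, and $\mathrm{MST}(\mathrm{G})$ is the weight of a minimum spanning tree of the complete graph on the colors with edge weights $w$. Packets arrive online; packet $i$ is a triple $(r_i, d_i, c_i)$ with release time $r_i \in \mathbb{N}_+$, deadline $d_i \in \mathbb{N}_+$ and color $c_i$. Time is slotted. In each time slot the switch either transmits one pending packet, is in a color-transition phase, or is idle. A scheduled packet $i$ must be transmitted in a slot in $[r_i, d_i]$, otherwise it is dropped. Between the transmission of a packet of color $j$ and the next transmitted packet of color $k \ne j$ there must be $w(j,k)$ transition slots. The goal is to maximize the number of transmitted packets. $\mathrm{ALG}(\sigma)$ and $\mathrm{OPT}(\sigma)$ denote the number of packets transmitted by the online algorithm and by an optimal offline schedule on input $\sigma$. The minimal laxity is $L = \min_i (d_i - r_i) \ge 1$. An online algorithm has competitive ratio $\rho \le 1$ if $E[\mathrm{ALG}(\sigma)] \ge \rho \cdot \mathrm{OPT}(\sigma)$ for every input $\sigma$.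 "No online algorithm can achieve a competitive ratio better than $1 - \Omega(f)$" means there is an absolute constant $c > 0$ such that for every online algorithm there is an input $\sigma$ with minimal laxity $L$ satisfying $E[\mathrm{ALG}(\sigma)] \le (1 - c f)\,\mathrm{OPT}(\sigma)$. *)

theory Defs
  imports "HOL-Probability.Probability"
begin

section \<open>Minimum spanning trees\<close>

text \<open>
  An undirected edge of the complete graph on \<^term>\<open>V\<close> is represented by the pair of its
  endpoints in increasing order, so that every edge is counted exactly once in the weight.
\<close>

definition complete_edges :: "nat set \<Rightarrow> (nat \<times> nat) set" where
  "complete_edges V = {(u, v). u \<in> V \<and> v \<in> V \<and> u < v}"

definition connects :: "nat set \<Rightarrow> (nat \<times> nat) set \<Rightarrow> bool" where
  "connects V E \<longleftrightarrow> (\<forall>u\<in>V. \<forall>v\<in>V. (u, v) \<in> (E \<union> E\<inverse>)\<^sup>*)"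

definition has_cycle :: "(nat \<times> nat) set \<Rightarrow> bool" where
  "has_cycle E \<longleftrightarrow> (\<exists>vs. length vs \<ge> 3 \<and> distinct vs \<and>
     (\<forall>i<length vs. (vs ! i, vs ! (Suc i mod length vs)) \<in> E \<union> E\<inverse>))"

definition spanning_tree :: "nat set \<Rightarrow> (nat \<times> nat) set \<Rightarrow> bool" where
  "spanning_tree V E \<longleftrightarrow> E \<subseteq> complete_edges V \<and> connects V E \<and> \<not> has_cycle E"

definition mst_weight :: "nat set \<Rightarrow> (nat \<Rightarrow> nat \<Rightarrow> real) \<Rightarrow> real" where
  "mst_weight V w = Min {(\<Sum>(u, v)\<in>E. w u v) | E. spanning_tree V E}"


section \<open>Packets, inputs and schedules\<close>

datatype packet = Packet (release: nat) (deadline: nat) (color: nat)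

text \<open>
  An input is a nonempty finite sequence of packets in the order of their arrival; packets are
  identified by their position in the sequence (two packets may be equal as triples).  Inputs are
  only used with \<^term>\<open>L \<ge> 1\<close>, where the truncated subtraction forces
  \<^term>\<open>release p < deadline p\<close>.
\<close>

definition valid_input :: "nat \<Rightarrow> nat \<Rightarrow> packet list \<Rightarrow> bool" where
  "valid_input C L \<sigma> \<longleftrightarrow> \<sigma> \<noteq> [] \<and> sorted (map release \<sigma>) \<and>
     (\<forall>p\<in>set \<sigma>. release p \<ge> 1 \<and> deadline p \<ge> 1 \<and> color p < C) \<and>
     Min ((\<lambda>p. deadline p - release p) ` set \<sigma>) = L"

datatype action = Transmit nat | Transition | Idle

text \<open>
  A schedule assigns an action to every slot; \<^term>\<open>Transmit i\<close> transmits the packet at position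
  \<^term>\<open>i\<close>.  Since release times are positive, nothing is ever transmitted in slot 0.
  The last condition also covers equal colors, where the transition cost is 0.
\<close>

definition feasible ::
  "(nat \<Rightarrow> nat \<Rightarrow> real) \<Rightarrow> packet list \<Rightarrow> (nat \<Rightarrow> action) \<Rightarrow> bool" where
  "feasible w \<sigma> s \<longleftrightarrow>
     (\<forall>t i. s t = Transmit i \<longrightarrow>
        i < length \<sigma> \<and> release (\<sigma> ! i) \<le> t \<and> t \<le> deadline (\<sigma> ! i)) \<and>
     (\<forall>t t' i. s t = Transmit i \<and> s t' = Transmit i \<longrightarrow> t = t') \<and>
     (\<forall>t t' i j. t < t' \<and> s t = Transmit i \<and> s t' = Transmit j \<and>
        (\<forall>u k. t < u \<and> u < t' \<longrightarrow> s u \<noteq> Transmit k) \<longrightarrow>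
        w (color (\<sigma> ! i)) (color (\<sigma> ! j)) \<le> real (card {u. t < u \<and> u < t' \<and> s u = Transition}))"

definition throughput :: "packet list \<Rightarrow> (nat \<Rightarrow> action) \<Rightarrow> nat" where
  "throughput \<sigma> s = card {i. i < length \<sigma> \<and> (\<exists>t. s t = Transmit i)}"

definition OPT :: "(nat \<Rightarrow> nat \<Rightarrow> real) \<Rightarrow> packet list \<Rightarrow> nat" where
  "OPT w \<sigma> = Max {throughput \<sigma> s | s. feasible w \<sigma> s}"


section \<open>Online algorithms\<close>

text \<open>
  A deterministic online algorithm chooses its action in slot \<^term>\<open>t\<close> from \<^term>\<open>t\<close> and the
  packets released up to \<^term>\<open>t\<close>.  As inputs are sorted by release time, these form a prefix of
  the input, so positions in the visible list and in the input agree.  The algorithm's own past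
  actions need not be an argument, as they are determined by the visible packets.
\<close>

type_synonym algorithm = "nat \<Rightarrow> packet list \<Rightarrow> action"

definition schedule_of :: "algorithm \<Rightarrow> packet list \<Rightarrow> nat \<Rightarrow> action" where
  "schedule_of A \<sigma> t = A t (filter (\<lambda>p. release p \<le> t) \<sigma>)"

definition ALG :: "algorithm \<Rightarrow> packet list \<Rightarrow> nat" where
  "ALG A \<sigma> = throughput \<sigma> (schedule_of A \<sigma>)"

definition online_algorithm ::
  "nat \<Rightarrow> (nat \<Rightarrow> nat \<Rightarrow> real) \<Rightarrow> nat \<Rightarrow> algorithm \<Rightarrow> bool" where
  "online_algorithm C w L A \<longleftrightarrow> (\<forall>\<sigma>. valid_input C L \<sigma> \<longrightarrow> feasible w \<sigma> (schedule_of A \<sigma>))"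

text \<open>
  A randomized online algorithm is a probability distribution over deterministic ones, on any
  sigma-algebra for which the throughput on each input is a random variable.
\<close>

definition randomized_online_algorithm ::
  "nat \<Rightarrow> (nat \<Rightarrow> nat \<Rightarrow> real) \<Rightarrow> nat \<Rightarrow> algorithm measure \<Rightarrow> bool" where
  "randomized_online_algorithm C w L P \<longleftrightarrow> prob_space P \<and>
     (\<forall>A\<in>space P. online_algorithm C w L A) \<and>
     (\<forall>\<sigma>. valid_input C L \<sigma> \<longrightarrow> (\<lambda>A. real (ALG A \<sigma>)) \<in> borel_measurable P)"

definition no_algorithm_better_than ::
  "nat \<Rightarrow> (nat \<Rightarrow> nat \<Rightarrow> real) \<Rightarrow> nat \<Rightarrow> real \<Rightarrow> bool" where
  "no_algorithm_better_than C w L \<rho> \<longleftrightarrow>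
     (\<forall>A. online_algorithm C w L A \<longrightarrow>
        (\<exists>\<sigma>. valid_input C L \<sigma> \<and> real (ALG A \<sigma>) \<le> \<rho> * real (OPT w \<sigma>))) \<and>
     (\<forall>P. randomized_online_algorithm C w L P \<longrightarrow>
        (\<exists>\<sigma>. valid_input C L \<sigma> \<and>
           prob_space.expectation P (\<lambda>A. real (ALG A \<sigma>)) \<le> \<rho> * real (OPT w \<sigma>)))"

end

theory Submission
  imports Defs
begin

text \<open>
  Packets of one color, the root, can be sent at any time, while packets of the other colors
  trickle in and fill half of the slots.  At a stopping time unknown to the algorithm, a flood of
  packets arrives which keeps the switch busy until the trickled packets expire.  Whatever is
  pending then is lost, and the initial packets served instead are missing later on, when the
  algorithm runs idle.  Hence an algorithm has to visit almost all colors in each of \<open>N\<close> short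
  intervals, at a cost of order \<open>W\<close>, the weight of a minimum spanning tree for the rounded distances.
  With \<open>N W\<close> arrivals per interval it loses order \<open>N W\<close> packets for some stopping
  time, also on average over its random choices.  An optimal schedule knows the stopping time and
  gets by with a few tours through all colors, logarithmically many in \<open>N\<close>: it starts with initial
  packets only, and each tour takes half of the time that is left.  The horizon is of order
  \<open>N\<^sup>2 W + L\<close>, and \<open>N\<close> of order \<open>sqrt (L / W)\<close> gives the bound.  In the
  arrivals a color is weighted by the length of the edge attaching it in Prim's algorithm, because
  any walk through the root is at least as long as these edges of the colors it visits.
\<close>

section \<open>Walks and minimum spanning trees\<close>

fun path_cost :: "('a \<Rightarrow> 'a \<Rightarrow> nat) \<Rightarrow> 'a list \<Rightarrow> nat" where
  "path_cost d (x # y # zs) = d x y + path_cost d (y # zs)"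
| "path_cost d _ = 0"

lemma path_cost_append:
  "path_cost d (xs @ x # ys) = path_cost d (xs @ [x]) + path_cost d (x # ys)"
  by (induction xs rule: induct_list012) auto

lemma path_cost_mono:
  assumes "\<And>x y. x \<in> set xs \<Longrightarrow> y \<in> set xs \<Longrightarrow> d x y \<le> d' x y"
  shows "path_cost d xs \<le> path_cost d' xs"
  using assms by (induction xs rule: induct_list012) (auto intro!: add_mono)

lemma path_cost_map: "path_cost d (map f xs) = path_cost (\<lambda>x y. d (f x) (f y)) xs"
  by (induction xs rule: induct_list012) auto

section \<open>Lower bound for walks from the edge lengths of Prim's algorithm\<close>

text \<open>
  The ultrametric on vertex ranks induced by the edge lengths of Prim's algorithm: the edge
  attaching rank \<^term>\<open>i\<close> is a shortest one leaving the vertices of smaller rank.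
\<close>

definition prim_dist :: "(nat \<Rightarrow> nat) \<Rightarrow> nat \<Rightarrow> nat \<Rightarrow> nat" where
  "prim_dist g a b = Max (insert 0 (g ` {min a b<..max a b}))"

lemma prim_dist_commute: "prim_dist g a b = prim_dist g b a"
  by (simp add: prim_dist_def min.commute max.commute)

lemma prim_dist_ge: "a < b \<Longrightarrow> g b \<le> prim_dist g a b"
  by (simp add: prim_dist_def)

lemma prim_dist_mono: "a \<le> b \<Longrightarrow> b \<le> x \<Longrightarrow> prim_dist g a b \<le> prim_dist g a x"
  unfolding prim_dist_def by (rule Max_mono) auto

lemma prim_dist_le:
  "(\<And>i. min a b < i \<Longrightarrow> i \<le> max a b \<Longrightarrow> g i \<le> n) \<Longrightarrow> prim_dist g a b \<le> n"
  by (auto simp: prim_dist_def)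

text \<open>As \<open>x\<close> has the largest rank, the ranks between \<open>a\<close> and
  \<open>b\<close> also lie between \<open>x\<close> and the smaller of the two, so one leg of the
  detour already pays for \<open>prim_dist g a b\<close>. The other leg, unless trivial, ends in
  \<open>x\<close> and pays for \<open>g x\<close>.\<close>

lemma prim_dist_detour:
  assumes "a \<le> x" "b \<le> x"
  shows "prim_dist g a b \<le> prim_dist g a x + prim_dist g x b"
    and "a \<noteq> x \<Longrightarrow> b \<noteq> x \<Longrightarrow> prim_dist g a b + g x \<le> prim_dist g a x + prim_dist g x b"
proof -
  show "prim_dist g a b \<le> prim_dist g a x + prim_dist g x b"
    using assms prim_dist_mono[of a b x g] prim_dist_mono[of b a x g]
    by (metis le_add1 le_add2 le_trans nle_le prim_dist_commute)
  assume "a \<noteq> x" "b \<noteq> x"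
  with assms have lt: "a < x" "b < x" by auto
  show "prim_dist g a b + g x \<le> prim_dist g a x + prim_dist g x b"
  proof (cases "a \<le> b")
    case True
    then show ?thesis
      using prim_dist_mono[of a b x g] prim_dist_ge[OF lt(2), of g] lt
      by (simp add: prim_dist_commute[of g x b] add_mono)
  next
    case False
    then show ?thesis
      using prim_dist_mono[of b a x g] prim_dist_ge[OF lt(1), of g] lt
      by (simp add: prim_dist_commute[of g x b] prim_dist_commute[of g a b])
  qed
qed

text \<open>Deleting an occurrence of the largest rank \<^term>\<open>x\<close> saves at least \<^term>\<open>g x\<close>
  when it is the last one, by the ultrametric inequality.\<close>

lemma sum_le_path_cost_prim_dist:
  assumes "xs \<noteq> []"
  shows "(\<Sum>x\<in>set xs. g x) \<le> path_cost (prim_dist g) xs + g (Min (set xs))"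
  using assms
proof (induction "length xs" arbitrary: xs rule: less_induct)
  case less
  let ?f = "prim_dist g"
  define x where "x = Max (set xs)"
  have "x \<in> set xs" using less.prems by (simp add: x_def)
  then obtain ys zs where xs: "xs = ys @ x # zs" by (auto simp: in_set_conv_decomp)
  have le: "a \<le> x" if "a \<in> set xs" for a using that by (simp add: x_def)
  show ?case
  proof (cases "ys @ zs = []")
    case True
    then show ?thesis by (simp add: xs)
  next
    case False
    \<comment> \<open>The weight that leaves the sum with this occurrence: none as long as
      \<open>x\<close> is visited elsewhere.\<close>
    define r where "r = (if x \<in> set (ys @ zs) then 0 else g x)"
    have drop: "path_cost ?f (ys @ zs) + r \<le> path_cost ?f xs"
    proof (cases ys rule: rev_cases)
      case Nil
      with False obtain b zs' where "zs = b # zs'" by (cases zs) auto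
      then show ?thesis
        using Nil le[of b] prim_dist_ge[of b x g] 
        by (auto simp: r_def xs prim_dist_commute[of g x b] le_less)
    next
      case (snoc ys' a)
      show ?thesis
      proof (cases zs)
        case Nil
        then show ?thesis
          using snoc le[of a] prim_dist_ge[of a x g] path_cost_append[of ?f ys' a "[x]"]
          by (auto simp: r_def xs le_less)
      next
        case (Cons b zs')
        have 1: "path_cost ?f xs
            = path_cost ?f (ys' @ [a]) + (?f a x + ?f x b + path_cost ?f (b # zs'))"
          using path_cost_append[of ?f ys' a "x # b # zs'"] by (simp add: xs snoc Cons)
        have 2: "path_cost ?f (ys @ zs)
            = path_cost ?f (ys' @ [a]) + (?f a b + path_cost ?f (b # zs'))"
          using path_cost_append[of ?f ys' a "b # zs'"] by (simp add: snoc Cons)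
        have "a \<le> x" "b \<le> x" by (auto intro!: le simp: xs snoc Cons)
        from prim_dist_detour[OF this, of g] show ?thesis
          unfolding 1 2 by (auto simp: r_def snoc Cons)
      qed
    qed
    have IH: "(\<Sum>x\<in>set (ys @ zs). g x)
        \<le> path_cost ?f (ys @ zs) + g (Min (set (ys @ zs)))"
      using False by (intro less.hyps) (auto simp: xs)
    have set: "set xs = insert x (set (ys @ zs))" by (auto simp: xs)
    \<comment> \<open>The correction term stands for the smallest rank visited, which no step of the
      walk has to pay for. Deleting the largest rank does not change it.\<close>
    have "Min (set (ys @ zs)) \<le> x"
    proof -
      from False obtain a where "a \<in> set (ys @ zs)" by (cases "ys @ zs") auto
      moreover from this have "a \<le> x" by (intro le) (auto simp: xs)
      ultimately show ?thesis by (meson List.finite_set Min_le order_trans)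
    qed
    then have "g (Min (set xs)) = g (Min (set (ys @ zs)))"
      using False by (simp only: set Min_insert[OF List.finite_set] set_empty min_absorb2 not_False_eq_True)
    moreover have "(\<Sum>x\<in>set xs. g x)
        = (\<Sum>x\<in>set (ys @ zs). g x) + r"
      unfolding set r_def by (simp add: sum.insert_if)
    ultimately show ?thesis using IH drop by linarith
  qed
qed

text \<open>Greedy choice: the next vertex is the far end of a shortest edge leaving the prefix. The
  earlier conditions speak of shorter prefixes only and survive the extension. For
  \<open>n = C\<close> this is a full run of Prim's algorithm.\<close>

lemma prim_order_exists:
  fixes d :: "nat \<Rightarrow> nat \<Rightarrow> nat"
  assumes "1 \<le> n" "n \<le> C"
  shows "\<exists>vs. length vs = n \<and> distinct vs \<and> set vs \<subseteq> {..<C} \<and>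
    (\<forall>i. 1 \<le> i \<and> i < n \<longrightarrow> (\<exists>p<i. \<forall>a<i. \<forall>b\<in>{..<C} - set (take i vs).
        d (vs ! p) (vs ! i) \<le> d (vs ! a) b))"
  using assms
proof (induction n rule: nat_induct_at_least)
  case base
  then show ?case by (intro exI[of _ "[0]"]) auto
next
  case (Suc n)
  have "n \<le> C" using Suc.prems by simp
  from Suc.IH[OF this] obtain vs where vs: "length vs = n" "distinct vs" "set vs \<subseteq> {..<C}"
    "\<forall>i. 1 \<le> i \<and> i < n \<longrightarrow> (\<exists>p<i. \<forall>a<i. \<forall>b\<in>{..<C} - set (take i vs).
        d (vs ! p) (vs ! i) \<le> d (vs ! a) b)"
    by blast
  have "card (set vs) < card {..<C}" using vs Suc.prems by (simp add: distinct_card)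
  then have "{..<C} - set vs \<noteq> {}"
    by (metis Diff_eq_empty_iff List.finite_set card_mono linorder_not_less)
  then obtain b0 where b0: "b0 \<in> {..<C} - set vs" by blast
  obtain pb where pb: "fst pb < n" "snd pb \<in> {..<C} - set vs"
    and least: "\<And>qb. fst qb < n \<Longrightarrow> snd qb \<in> {..<C} - set vs
      \<Longrightarrow> d (vs ! fst pb) (snd pb) \<le> d (vs ! fst qb) (snd qb)"
    using ex_has_least_nat[of "\<lambda>qb. fst qb < n \<and> snd qb \<in> {..<C} - set vs" "(0, b0)"
        "\<lambda>qb. d (vs ! fst qb) (snd qb)"] b0 Suc.hyps by auto
  show ?case
  proof (intro exI[of _ "vs @ [snd pb]"] conjI allI impI)
    fix i assume i: "1 \<le> i \<and> i < Suc n"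
    show "\<exists>p<i. \<forall>a<i. \<forall>b\<in>{..<C} - set (take i (vs @ [snd pb])).
      d ((vs @ [snd pb]) ! p) ((vs @ [snd pb]) ! i) \<le> d ((vs @ [snd pb]) ! a) b"
    proof (cases "i = n")
      case True
      have "d (vs ! fst pb) (snd pb) \<le> d (vs ! a) b" if "a < n" "b \<in> {..<C} - set vs" for a b
        using least[of "(a, b)"] that by simp
      then show ?thesis
        using pb(1) vs(1) True by (intro exI[of _ "fst pb"]) (simp add: nth_append)
    next
      case False
      then have "i < n" using i by simp
      then obtain p where p: "p < i" "\<forall>a<i. \<forall>b\<in>{..<C} - set (take i vs).
          d (vs ! p) (vs ! i) \<le> d (vs ! a) b"
        using vs(4) i by blast
      with \<open>i < n\<close> vs(1) show ?thesis by (intro exI[of _ p]) (simp add: nth_append)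
    qed
  qed (use pb vs in auto)
qed

text \<open>Insert \<open>v\<close> right behind \<open>p\<close>. If \<open>q\<close> follows
  \<open>p\<close>, the new step from \<open>v\<close> to \<open>q\<close> costs at most
  \<open>d p v + d p q\<close>, by going back through \<open>p\<close>.\<close>

lemma closed_tour_insert:
  fixes d :: "nat \<Rightarrow> nat \<Rightarrow> nat"
  assumes sym: "\<And>a b. d a b = d b a"
    and tri: "\<And>a b c. a < C \<Longrightarrow> b < C \<Longrightarrow> c < C \<Longrightarrow> d a c \<le> d a b + d b c"
    and bounds: "set (r # os) \<subseteq> {..<C}" "v < C" and p: "p \<in> set (r # os)"
  shows "\<exists>os'. set os' = insert v (set os) \<and> length os' = Suc (length os) \<and>
    path_cost d (r # os' @ [r]) \<le> path_cost d (r # os @ [r]) + 2 * d p v"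
proof -
  from split_list[OF p] obtain as bs where split: "r # os = as @ p # bs" by blast
  \<comment> \<open>If \<open>as\<close> is empty, \<open>p\<close> is the root itself and
    \<open>tl\<close> removes it from the new tour.\<close>
  define os' where "os' = tl (as @ p # v # bs)"
  have os': "r # os' = as @ p # v # bs"
    using split by (cases as) (auto simp: os'_def)
  obtain q qs where q: "bs @ [r] = q # qs" by (cases "bs @ [r]") auto
  have "q \<in> set (bs @ [r])" unfolding q by simp
  moreover have "set bs \<subseteq> set (r # os)" unfolding split by auto
  ultimately have "q < C" "p < C" using bounds(1) p by (auto simp: subset_iff)
  then have "d v q \<le> d p v + d p q" using tri[of v p q] bounds(2) sym[of v p] by simp
  moreover have "(r # os') @ [r] = as @ p # v # q # qs" unfolding os' by (simp add: q)
  then have "path_cost d (r # os' @ [r])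
      = path_cost d (as @ [p]) + (d p v + (d v q + path_cost d (q # qs)))"
    using path_cost_append[of d as p "v # q # qs"] by simp
  moreover have "(r # os) @ [r] = as @ p # q # qs" unfolding split by (simp add: q)
  then have "path_cost d (r # os @ [r]) = path_cost d (as @ [p]) + (d p q + path_cost d (q # qs))"
    using path_cost_append[of d as p "q # qs"] by simp
  ultimately have cost: "path_cost d (r # os' @ [r]) \<le> path_cost d (r # os @ [r]) + 2 * d p v"
    by linarith
  have "length (r # os') = Suc (length (r # os))" unfolding os' split by simp
  then have length: "length os' = Suc (length os)" by simp
  have "set os' = insert v (set os)"
    using os' split by (cases as) auto
  with cost length show ?thesis by blast
qed

text \<open>Walking around a tree uses every edge twice: inserting the vertices in Prim order, each
  behind its parent, adds at most twice the edge to the parent.\<close>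

lemma closed_tour_prim:
  fixes d :: "nat \<Rightarrow> nat \<Rightarrow> nat"
  assumes sym: "\<And>a b. d a b = d b a"
    and tri: "\<And>a b c. a < C \<Longrightarrow> b < C \<Longrightarrow> c < C \<Longrightarrow> d a c \<le> d a b + d b c"
    and vs: "set vs \<subseteq> {..<C}" and parent: "\<And>i. 1 \<le> i \<Longrightarrow> i < length vs \<Longrightarrow> P i < i"
    and refl: "d (vs ! 0) (vs ! 0) = 0"
    and n: "1 \<le> n" "n \<le> length vs"
  shows "\<exists>os. set (vs ! 0 # os) = set (take n vs) \<and> length os = n - 1 \<and>
    path_cost d (vs ! 0 # os @ [vs ! 0]) \<le> 2 * (\<Sum>i\<in>{1..<n}. d (vs ! P i) (vs ! i))"
  using n
proof (induction n rule: nat_induct_at_least)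
  case base
  then show ?case using refl by (cases vs) (auto intro: exI[of _ "[]"])
next
  case (Suc n)
  then obtain os where os: "set (vs ! 0 # os) = set (take n vs)" "length os = n - 1"
    "path_cost d (vs ! 0 # os @ [vs ! 0]) \<le> 2 * (\<Sum>i\<in>{1..<n}. d (vs ! P i) (vs ! i))"
    by auto
  have "vs ! P n \<in> set (take n vs)"
    using parent[of n] Suc by (auto simp: in_set_conv_nth)
  moreover have "set (vs ! 0 # os) \<subseteq> {..<C}" using os(1) vs set_take_subset[of n vs] by auto
  moreover have "vs ! n < C" using vs Suc.prems nth_mem[of n vs] by (auto simp del: nth_mem)
  moreover have "vs ! P n \<in> set (vs ! 0 # os)" unfolding os(1) by fact
  ultimately have "\<exists>os'. set os' = insert (vs ! n) (set os) \<and> length os' = Suc (length os) \<and>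
      path_cost d (vs ! 0 # os' @ [vs ! 0])
        \<le> path_cost d (vs ! 0 # os @ [vs ! 0]) + 2 * d (vs ! P n) (vs ! n)"
    using tri by (intro closed_tour_insert[of d C] sym) blast+
  then obtain os' where os': "set os' = insert (vs ! n) (set os)" "length os' = Suc (length os)"
    "path_cost d (vs ! 0 # os' @ [vs ! 0])
      \<le> path_cost d (vs ! 0 # os @ [vs ! 0]) + 2 * d (vs ! P n) (vs ! n)"
    by blast
  have "set (vs ! 0 # os') = insert (vs ! n) (set (vs ! 0 # os))" using os'(1) by auto
  also have "\<dots> = set (take (Suc n) vs)"
    unfolding os(1) using Suc.prems by (simp add: take_Suc_conv_app_nth)
  finally show ?case
    using os(2,3) os'(2,3) Suc.hyps by (intro exI[of _ os']) simp
qed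


text \<open>The edges to the parents form a spanning tree. Parents have smaller indices, so every
  vertex leads down to the first one. On a cycle, the vertex of largest index would have two
  distinct neighbours of smaller index, but its parent is the only candidate.\<close>

lemma mst_weight_le_prim:
  fixes w :: "nat \<Rightarrow> nat \<Rightarrow> real"
  assumes sym: "\<And>a b. w a b = w b a" and vs: "distinct vs" "set vs = V"
    and parent: "\<And>i. 1 \<le> i \<Longrightarrow> i < length vs \<Longrightarrow> P i < i"
  shows "mst_weight V w \<le> (\<Sum>i\<in>{1..<length vs}. w (vs ! P i) (vs ! i))"
proof -
  let ?n = "length vs"
  define edge where "edge i = (min (vs ! P i) (vs ! i), max (vs ! P i) (vs ! i))" for i
  define E where "E = edge ` {1..<?n}"
  have sub: "E \<subseteq> complete_edges V"
  proof
    fix ab assume "ab \<in> E"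
    then obtain i where i: "1 \<le> i" "i < ?n" "ab = edge i" by (auto simp: E_def)
    moreover have "vs ! P i \<noteq> vs ! i"
      using i parent[of i] vs(1) by (simp add: nth_eq_iff_index_eq)
    ultimately show "ab \<in> complete_edges V"
      using vs(2) parent[of i] by (auto simp: complete_edges_def edge_def min_def max_def)
  qed
  have adj: "(vs ! P i, vs ! i) \<in> E \<union> E\<inverse>" "(vs ! i, vs ! P i) \<in> E \<union> E\<inverse>"
    if "1 \<le> i" "i < ?n" for i
  proof -
    have "edge i \<in> E" using that by (simp add: E_def)
    then show "(vs ! P i, vs ! i) \<in> E \<union> E\<inverse>" "(vs ! i, vs ! P i) \<in> E \<union> E\<inverse>"
      by (auto simp: edge_def min_def max_def split: if_splits)
  qed
  have adjD: "a = P b" if "(vs ! a, vs ! b) \<in> E \<union> E\<inverse>" "a < b" "b < ?n" for a b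
  proof -
    from that(1) obtain i where i: "1 \<le> i" "i < ?n" "{vs ! a, vs ! b} = {vs ! P i, vs ! i}"
      by (auto simp: E_def edge_def min_def max_def insert_commute split: if_splits)
    have "P i < i" using i parent by simp
    then have "(a = P i \<and> b = i) \<or> (a = i \<and> b = P i)"
      using that(2,3) i vs(1) by (simp add: doubleton_eq_iff nth_eq_iff_index_eq)
    then show ?thesis using that(2) \<open>P i < i\<close> by auto
  qed
  have to_root: "(vs ! i, vs ! 0) \<in> (E \<union> E\<inverse>)\<^sup>*" if "i < ?n" for i
    using that
  proof (induction i rule: less_induct)
    case (less i)
    show ?case
    proof (cases "i = 0")
      case False
      then have i: "1 \<le> i" by simp
      have "(vs ! P i, vs ! 0) \<in> (E \<union> E\<inverse>)\<^sup>*"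
        using less.IH[of "P i"] less.prems parent[OF i] by simp
      with adj(2)[OF i less.prems] show ?thesis by (rule converse_rtrancl_into_rtrancl)
    qed simp
  qed
  have "sym ((E \<union> E\<inverse>)\<^sup>*)" by (intro sym_rtrancl sym_Un_converse)
  have conn: "connects V E"
    unfolding connects_def
  proof (intro ballI)
    fix u v assume "u \<in> V" "v \<in> V"
    then obtain i j where "i < ?n" "u = vs ! i" "j < ?n" "v = vs ! j"
      unfolding vs(2)[symmetric] in_set_conv_nth by blast
    with to_root[of i] to_root[of j] \<open>sym _\<close> show "(u, v) \<in> (E \<union> E\<inverse>)\<^sup>*"
      by (meson rtrancl_trans symD)
  qed
  have acyclic: "\<not> has_cycle E"
  proof
    assume "has_cycle E"
    then obtain cs where "length cs \<ge> 3 \<and> distinct cs \<and>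
        (\<forall>i<length cs. (cs ! i, cs ! (Suc i mod length cs)) \<in> E \<union> E\<inverse>)"
      unfolding has_cycle_def ..
    then have cs: "length cs \<ge> 3" "distinct cs"
      "\<And>i. i < length cs \<Longrightarrow> (cs ! i, cs ! (Suc i mod length cs)) \<in> E \<union> E\<inverse>"
      by simp_all
    let ?m = "length cs"
    have "E \<union> E\<inverse> \<subseteq> V \<times> V" using sub by (auto simp: complete_edges_def)
    then have "cs ! i \<in> V" if "i < ?m" for i by (rule subsetD[THEN SigmaD1, OF _ cs(3)[OF that]])
    then have ex: "\<exists>j<?n. vs ! j = cs ! i" if "i < ?m" for i
      using that unfolding vs(2)[symmetric] in_set_conv_nth .
    define k where "k i = (SOME j. j < ?n \<and> vs ! j = cs ! i)" for i
    have k: "k i < ?n \<and> vs ! k i = cs ! i" if "i < ?m" for i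
      unfolding k_def using ex[OF that] by (rule someI_ex)
    have k_inj: "k i \<noteq> k i'" if "i < ?m" "i' < ?m" "i \<noteq> i'" for i i'
    proof
      assume "k i = k i'"
      then have "cs ! i = cs ! i'" using k[OF that(1)] k[OF that(2)] by simp
      then show False using that cs(2) by (simp add: nth_eq_iff_index_eq)
    qed
    have "0 < ?m" using cs(1) by linarith
    then have "Max (k ` {..<?m}) \<in> k ` {..<?m}" by (intro Max_in) auto
    then obtain i where i: "i < ?m" and max: "Max (k ` {..<?m}) = k i" by blast
    have i_max: "k i' \<le> k i" if "i' < ?m" for i'
      unfolding max[symmetric] using that by (intro Max_ge) auto
    \<comment> \<open>The cyclic neighbours of \<open>i\<close>; a length of at least 3 keeps them
      distinct.\<close>
    define nx where "nx = (if Suc i = ?m then 0 else Suc i)"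
    define pr where "pr = (if i = 0 then ?m - 1 else i - 1)"
    have nx_mod: "nx = Suc i mod ?m" using i by (simp add: nx_def)
    have lt: "nx < ?m" "pr < ?m" "nx \<noteq> i" "pr \<noteq> i" "nx \<noteq> pr" "Suc pr mod ?m = i"
    proof -
      show "nx < ?m" "nx \<noteq> i" "pr < ?m" "pr \<noteq> i" "nx \<noteq> pr"
        unfolding nx_def pr_def using i cs(1) by (auto simp flip: length_greater_0_conv)
      show "Suc pr mod ?m = i" unfolding pr_def using i \<open>0 < ?m\<close> by (simp del: length_greater_0_conv)
    qed
    have "(vs ! k i, vs ! k nx) \<in> E \<union> E\<inverse>" "(vs ! k pr, vs ! k i) \<in> E \<union> E\<inverse>"
      using cs(3)[OF i] cs(3)[OF lt(2)] k[OF i] k[OF lt(1)] k[OF lt(2)] lt(6)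
      by (simp_all add: nx_mod)
    then have "(vs ! k nx, vs ! k i) \<in> E \<union> E\<inverse>" "(vs ! k pr, vs ! k i) \<in> E \<union> E\<inverse>" by auto
    moreover have "k nx < k i" "k pr < k i"
      using i_max[OF lt(1)] i_max[OF lt(2)] k_inj[OF lt(1) i lt(3)] k_inj[OF lt(2) i lt(4)]
      by simp_all
    ultimately have "k nx = P (k i)" "k pr = P (k i)"
      using adjD[of "k nx" "k i"] adjD[of "k pr" "k i"] k[OF i] by blast+
    then show False using k_inj[OF lt(1,2,5)] by simp
  qed
  have "finite V" unfolding vs(2)[symmetric] by simp
  have "complete_edges V \<subseteq> V \<times> V" by (auto simp: complete_edges_def)
  then have "finite (complete_edges V)"
    by (rule finite_subset) (simp add: \<open>finite V\<close>)
  moreover have "{E. spanning_tree V E} \<subseteq> Pow (complete_edges V)"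
    by (auto simp: spanning_tree_def)
  ultimately have "finite {E. spanning_tree V E}" by (auto intro: finite_subset)
  then have "mst_weight V w \<le> (\<Sum>(u, v)\<in>E. w u v)"
    unfolding mst_weight_def using sub conn acyclic
    by (intro Min_le) (auto simp: spanning_tree_def simp flip: Setcompr_eq_image)
  also have "\<dots> = (\<Sum>i\<in>{1..<?n}. case edge i of (u, v) \<Rightarrow> w u v)"
    unfolding E_def
  \<comment> \<open>The child is the endpoint of larger index, so an edge determines the index it
    comes from.\<close>
  proof (rule sum.reindex[unfolded comp_def], rule inj_onI)
    fix i i' assume i: "i \<in> {1..<?n}" "i' \<in> {1..<?n}" and eq: "edge i = edge i'"
    have "{min a b, max a b} = {a, b}" for a b :: nat by (auto simp: min_def max_def)
    then have "{vs ! P i, vs ! i} = {vs ! P i', vs ! i'}"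
      using eq unfolding edge_def prod.inject by metis
    moreover have "P i < i" "P i' < i'" using i parent by simp_all
    ultimately show "i = i'"
      using i vs(1) by (auto simp: doubleton_eq_iff nth_eq_iff_index_eq)
  qed
  also have "\<dots> = (\<Sum>i\<in>{1..<?n}. w (vs ! P i) (vs ! i))"
    by (intro sum.cong) (auto simp: edge_def min_def max_def sym)
  finally show ?thesis .
qed

text \<open>The triangle inequality survives rounding up because ceilings are subadditive.\<close>

lemma nat_ceiling_metric:
  fixes w :: "'a \<Rightarrow> 'a \<Rightarrow> real"
  assumes "Metric_space S w"
  shows "nat \<lceil>w a b\<rceil> = nat \<lceil>w b a\<rceil>" and "a \<in> S \<Longrightarrow> nat \<lceil>w a a\<rceil> = 0"
    and "a \<in> S \<Longrightarrow> b \<in> S \<Longrightarrow> c \<in> S \<Longrightarrow> nat \<lceil>w a c\<rceil> \<le> nat \<lceil>w a b\<rceil> + nat \<lceil>w b c\<rceil>"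
proof -
  interpret Metric_space S w by (fact assms)
  show "nat \<lceil>w a b\<rceil> = nat \<lceil>w b a\<rceil>" by (simp add: commute)
  show "nat \<lceil>w a a\<rceil> = 0" if "a \<in> S" using that by simp
  show "nat \<lceil>w a c\<rceil> \<le> nat \<lceil>w a b\<rceil> + nat \<lceil>w b c\<rceil>" if "a \<in> S" "b \<in> S" "c \<in> S"
  proof -
    have "w a c \<le> w a b + w b c" using that by (intro triangle) auto
    then have "\<lceil>w a c\<rceil> \<le> \<lceil>w a b\<rceil> + \<lceil>w b c\<rceil>" by linarith
    moreover have "0 \<le> \<lceil>w a b\<rceil>" "0 \<le> \<lceil>w b c\<rceil>"
      using nonneg[of a b] nonneg[of b c] by linarith+
    ultimately show ?thesis by (simp only: nat_mono flip: nat_add_distrib)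
  qed
qed

text \<open>The bounds on walks and tours are those of the rounded distances \<^term>\<open>\<lceil>w a b\<rceil>\<close>,
  which is what a transition costs in slots.\<close>

lemma prim_weights:
  fixes w :: "nat \<Rightarrow> nat \<Rightarrow> real"
  assumes C: "1 \<le> C" and metric: "Metric_space {..<C} w"
  defines "d \<equiv> \<lambda>a b. nat \<lceil>w a b\<rceil>"
  obtains root e ord where "root < C" "e root = 0" "mst_weight {..<C} w \<le> real (\<Sum>c<C. e c)"
    and "\<And>xs. set xs \<subseteq> {..<C} \<Longrightarrow> root \<in> set xs \<Longrightarrow> (\<Sum>c\<in>set xs. e c) \<le> path_cost d xs"
    and "distinct ord" "set ord = {..<C} - {root}"
    and "path_cost d (root # ord @ [root]) \<le> 2 * (\<Sum>c<C. e c)"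
proof -
  interpret Metric_space "{..<C}" w by (fact metric)
  have sym: "d a b = d b a" for a b
    unfolding d_def by (rule nat_ceiling_metric(1)[OF metric])
  have refl: "d a a = 0" if "a < C" for a
    unfolding d_def by (rule nat_ceiling_metric(2)[OF metric]) (simp add: that)
  have tri: "d a c \<le> d a b + d b c" if "a < C" "b < C" "c < C" for a b c
    unfolding d_def by (rule nat_ceiling_metric(3)[OF metric]) (simp_all add: that)
  obtain vs where vs: "length vs = C" "distinct vs" "set vs \<subseteq> {..<C}"
    and ex: "\<And>i. 1 \<le> i \<Longrightarrow> i < C \<Longrightarrow> \<exists>p<i. \<forall>a<i. \<forall>b\<in>{..<C} - set (take i vs).
        d (vs ! p) (vs ! i) \<le> d (vs ! a) b"
    using prim_order_exists[of C C d] C by blast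
  have set_vs: "set vs = {..<C}"
    using vs by (intro card_subset_eq) (auto simp: distinct_card)
  define P where "P i = (SOME p. p < i \<and> (\<forall>a<i. \<forall>b\<in>{..<C} - set (take i vs).
      d (vs ! p) (vs ! i) \<le> d (vs ! a) b))" for i
  have "P i < i \<and> (\<forall>a<i. \<forall>b\<in>{..<C} - set (take i vs). d (vs ! P i) (vs ! i) \<le> d (vs ! a) b)"
    if "1 \<le> i" "i < C" for i
    unfolding P_def using ex[OF that] by (rule someI_ex)
  then have P: "P i < i"
    and cut: "a < i \<Longrightarrow> b \<in> {..<C} - set (take i vs) \<Longrightarrow> d (vs ! P i) (vs ! i) \<le> d (vs ! a) b"
    if "1 \<le> i" "i < C" for i a b
    using that by blast+
  define g where "g i = (if i = 0 then 0 else d (vs ! P i) (vs ! i))" for i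
  define rk where "rk = inv_into {..<C} ((!) vs)"
  have bij: "bij_betw ((!) vs) {..<C} {..<C}"
    by (rule bij_betw_nth[OF vs(2)]) (simp_all only: vs(1) set_vs)
  have img: "(!) vs ` {..<C} = {..<C}" using bij by (rule bij_betw_imp_surj_on)
  have rk: "rk c < C" "vs ! rk c = c" if "c < C" for c
  proof -
    have c: "c \<in> (!) vs ` {..<C}" unfolding img using that by simp
    show "rk c < C" using inv_into_into[OF c] by (simp add: rk_def)
    show "vs ! rk c = c" using f_inv_into_f[OF c] by (simp add: rk_def)
  qed
  have rk_nth: "rk (vs ! i) = i" if "i < C" for i
    using bij_betw_inv_into_left[OF bij, of i] that by (simp add: rk_def)
  have rk_inj: "inj_on rk {..<C}" by (rule inj_on_inverseI[of _ "(!) vs"]) (simp add: rk)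
  define e where "e c = g (rk c)" for c
  have sum_g: "(\<Sum>c<C. e c) = (\<Sum>i<C. g i)"
    unfolding e_def by (rule sum.reindex_bij_witness[of _ "(!) vs" rk])
      (use rk rk_nth bij in \<open>auto simp: bij_betw_def\<close>)
  have "{..<C} = insert 0 {1..<C}" using C by auto
  then have sum_g': "(\<Sum>i<C. g i) = (\<Sum>i\<in>{1..<C}. d (vs ! P i) (vs ! i))"
    by (auto simp: g_def intro!: sum.cong)
  have root: "vs ! 0 < C" using vs(1) C set_vs nth_mem[of 0 vs] by auto
  have "path_cost d xs \<ge> (\<Sum>c\<in>set xs. e c)" if xs: "set xs \<subseteq> {..<C}" "vs ! 0 \<in> set xs" for xs
  proof -
    \<comment> \<open>Every \<open>i\<close> with \<open>rk x < i \<le> rk y\<close> yields a cut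
      with \<open>x\<close> among the first \<open>i\<close> vertices and \<open>y\<close> outside.
      The edge of length \<open>g i\<close> is a shortest one across it.\<close>
    have lt: "prim_dist g (rk x) (rk y) \<le> d x y" if xy: "rk x < rk y" "x < C" "y < C" for x y
    proof (rule prim_dist_le)
      fix i assume i: "min (rk x) (rk y) < i" "i \<le> max (rk x) (rk y)"
      have "y \<notin> set (take i vs)"
      proof
        assume "y \<in> set (take i vs)"
        then obtain k where "k < i" "k < C" "y = vs ! k" using vs(1) by (auto simp: in_set_conv_nth)
        with rk_nth[of k] i xy show False by simp
      qed
      then have "d (vs ! P i) (vs ! i) \<le> d (vs ! rk x) y"
        using i xy rk(1)[of y] by (intro cut) auto
      then show "g i \<le> d x y" using rk(2)[of x] xy by (simp add: g_def)
    qed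
    have le: "prim_dist g (rk x) (rk y) \<le> d x y" if "x < C" "y < C" for x y
    proof (cases "rk x" "rk y" rule: linorder_cases)
      case equal
      then show ?thesis by (simp add: prim_dist_def)
    next
      case greater
      then show ?thesis using lt[of y x] that by (simp add: prim_dist_commute[of g "rk x"] sym[of x])
    qed (use lt that in blast)
    \<comment> \<open>The walk meets the root, which has rank 0 and \<open>g 0 = 0\<close>, so the
      correction term vanishes.\<close>
    have "0 \<in> set (map rk xs)" using xs(2) rk_nth[of 0] C by force
    then have "Min (set (map rk xs)) = 0" by (intro Min_eqI) auto
    then have "sum g (set (map rk xs)) \<le> path_cost (prim_dist g) (map rk xs)"
      using sum_le_path_cost_prim_dist[of "map rk xs" g] xs(2) g_def[of 0] by fastforce
    also have "\<dots> \<le> path_cost d xs"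
      unfolding path_cost_map using xs(1) le by (intro path_cost_mono) auto
    also have "sum g (set (map rk xs)) = sum e (set xs)"
      using rk_inj xs(1) by (simp add: e_def[abs_def] sum.reindex inj_on_subset)
    finally show ?thesis .
  qed
  moreover obtain os where os: "set (vs ! 0 # os) = {..<C}" "length os = C - 1"
    "path_cost d (vs ! 0 # os @ [vs ! 0]) \<le> 2 * (\<Sum>c<C. e c)"
    using closed_tour_prim[of d C vs P C, OF sym tri] vs set_vs P C refl[OF root]
    unfolding sum_g sum_g' by auto
  moreover have "distinct (vs ! 0 # os)"
    using os C by (intro card_distinct) simp
  moreover from this os(1) have "set os = {..<C} - {vs ! 0}" by auto
  moreover have "mst_weight {..<C} w \<le> real (\<Sum>c<C. e c)"
  proof -
    have "mst_weight {..<C} w \<le> (\<Sum>i\<in>{1..<C}. w (vs ! P i) (vs ! i))"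
      using mst_weight_le_prim[of w vs "{..<C}" P] commute vs set_vs P by auto
    also have "\<dots> \<le> (\<Sum>i\<in>{1..<C}. real (d (vs ! P i) (vs ! i)))"
      by (intro sum_mono) (simp add: d_def)
    finally show ?thesis by (simp add: sum_g sum_g')
  qed
  moreover have "e (vs ! 0) = 0" using rk_nth[of 0] C by (simp add: e_def g_def)
  ultimately show ?thesis using root by (intro that[of "vs ! 0" e os]) auto
qed

section \<open>Schedules and walks\<close>

lemma path_cost_take_Suc:
  "Suc r < length xs \<Longrightarrow>
    path_cost d (take (Suc (Suc r)) xs) = path_cost d (take (Suc r) xs) + d (xs ! r) (xs ! Suc r)"
  using path_cost_append[of d "take r xs" "xs ! r" "[xs ! Suc r]"]
  by (simp add: take_Suc_conv_app_nth)

lemma path_cost_take_le: "path_cost d (take k xs) \<le> path_cost d xs"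
proof (induction xs arbitrary: k rule: induct_list012)
  case (3 x y zs)
  show ?case
  proof (cases k)
    case (Suc k')
    with 3(2)[of k'] show ?thesis by (cases k') auto
  qed simp
qed (auto simp: take_Cons')

lemma path_cost_take_strict_mono:
  assumes "r < r'" "r' < length xs"
  shows "path_cost d (take (Suc r) xs) + d (xs ! r) (xs ! Suc r) \<le> path_cost d (take (Suc r') xs)"
proof -
  have "path_cost d (take (Suc (Suc r)) (take (Suc r') xs)) \<le> path_cost d (take (Suc r') xs)"
    by (rule path_cost_take_le)
  with assms show ?thesis by (simp add: path_cost_take_Suc min_absorb1)
qed

lemma throughput_le_length: "throughput \<sigma> s \<le> length \<sigma>"
  using card_mono[of "{..<length \<sigma>}" "{i. i < length \<sigma> \<and> (\<exists>t. s t = Transmit i)}"]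
  by (auto simp: throughput_def)

lemma finite_throughputs: "finite {throughput \<sigma> s | s. feasible w \<sigma> s}"
  by (rule finite_subset[of _ "{..length \<sigma>}"]) (auto simp: throughput_le_length)

lemma throughput_le_OPT: "feasible w \<sigma> s \<Longrightarrow> throughput \<sigma> s \<le> OPT w \<sigma>"
  unfolding OPT_def by (rule Max_ge[OF finite_throughputs]) auto

lemma OPT_le_length: "OPT w \<sigma> \<le> length \<sigma>"
proof -
  have "feasible w \<sigma> (\<lambda>_. Idle)" by (simp add: feasible_def)
  then show ?thesis
    unfolding OPT_def by (subst Max_le_iff[OF finite_throughputs]) (auto simp: throughput_le_length)
qed

text \<open>The packets of \<open>rs\<close> are sent in this order as early as the transitions
  permit: \<open>slot r\<close> counts the \<open>r\<close> earlier packets, all transitions so far,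
  and one more because slot 0 stays empty.\<close>

lemma length_le_OPT:
  fixes w :: "nat \<Rightarrow> nat \<Rightarrow> real" and \<sigma> rs
  defines "cs \<equiv> map (\<lambda>i. color (\<sigma> ! i)) rs"
  defines "slot r \<equiv> Suc (r + path_cost (\<lambda>a b. nat \<lceil>w a b\<rceil>) (take (Suc r) cs))"
  assumes rs: "distinct rs" "set rs \<subseteq> {..<length \<sigma>}"
    and window: "\<And>r. r < length rs \<Longrightarrow>
      release (\<sigma> ! (rs ! r)) \<le> slot r \<and> slot r \<le> deadline (\<sigma> ! (rs ! r))"
  shows "length rs \<le> OPT w \<sigma>"
proof -
  let ?n = "length rs" and ?d = "\<lambda>a b. nat \<lceil>w a b\<rceil>"
  have next_slot: "slot r + ?d (cs ! r) (cs ! Suc r) < slot r'" if "r < r'" "r' < ?n" for r r'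
    using path_cost_take_strict_mono[of r r' cs ?d] that by (simp add: slot_def cs_def)
  have mono: "slot r < slot r'" if "r < r'" "r' < ?n" for r r'
    using next_slot[OF that] by simp
  have slot_inj: "inj_on slot {..<?n}"
    by (rule linorder_inj_onI') (use mono in force)
  \<comment> \<open>All other slots may be \<open>Transition\<close>, since \<open>feasible\<close>
    asks for a minimal number of transitions between two packets, not for an exact one.\<close>
  define s where "s t = (if t \<in> slot ` {..<?n}
    then Transmit (rs ! inv_into {..<?n} slot t) else Transition)" for t
  have s_slot: "s (slot r) = Transmit (rs ! r)" if "r < ?n" for r
    using that slot_inj by (simp add: s_def inv_into_f_f)
  have s_cases: "\<exists>r<?n. t = slot r \<and> i = rs ! r" if "s t = Transmit i" for t i
    using that slot_inj by (auto simp: s_def inv_into_f_f split: if_splits)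
  have "feasible w \<sigma> s"
    unfolding feasible_def
  proof (intro conjI allI impI)
    fix t i assume "s t = Transmit i"
    then obtain r where r: "r < ?n" "t = slot r" "i = rs ! r" using s_cases by blast
    then show "i < length \<sigma>" using subsetD[OF rs(2) nth_mem[OF r(1)]] by simp
    show "release (\<sigma> ! i) \<le> t" "t \<le> deadline (\<sigma> ! i)" using window r by auto
  next
    fix t t' i assume "s t = Transmit i \<and> s t' = Transmit i"
    then show "t = t'" using s_cases[of t i] s_cases[of t' i] rs(1)
      by (auto simp: nth_eq_iff_index_eq)
  next
    fix t t' i j
    assume *: "t < t' \<and> s t = Transmit i \<and> s t' = Transmit j \<and>
      (\<forall>u k. t < u \<and> u < t' \<longrightarrow> s u \<noteq> Transmit k)"
    obtain r where r: "r < ?n" "t = slot r" "i = rs ! r" using s_cases * by blast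
    obtain r' where r': "r' < ?n" "t' = slot r'" "j = rs ! r'" using s_cases * by blast
    have "r < r'" using * r r' mono[of r' r] by (metis linorder_neqE_nat order_less_asym less_irrefl)
    have "r' = Suc r"
    proof (rule ccontr)
      assume "r' \<noteq> Suc r"
      then have "Suc r < r'" using \<open>r < r'\<close> by simp
      then have "t < slot (Suc r)" "slot (Suc r) < t'" "s (slot (Suc r)) = Transmit (rs ! Suc r)"
        using mono s_slot r r' by auto
      with * show False by blast
    qed
    have "{u. t < u \<and> u < t' \<and> s u = Transition} = {t<..<t'}"
      using * by (auto simp: s_def split: if_splits)
    then have "card {u. t < u \<and> u < t' \<and> s u = Transition} = t' - Suc t" by simp
    moreover have "?d (cs ! r) (cs ! r') \<le> t' - Suc t"
      using next_slot[OF \<open>r < r'\<close> r'(1)] unfolding r(2) r'(2) \<open>r' = Suc r\<close> by linarith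
    moreover have "cs ! r = color (\<sigma> ! i)" "cs ! r' = color (\<sigma> ! j)"
      using r r' by (simp_all add: cs_def)
    ultimately show "w (color (\<sigma> ! i)) (color (\<sigma> ! j))
        \<le> real (card {u. t < u \<and> u < t' \<and> s u = Transition})"
      by (simp add: nat_le_iff ceiling_le_iff)
  qed
  moreover have "length rs \<le> throughput \<sigma> s"
  proof -
    have "set rs \<subseteq> {i. i < length \<sigma> \<and> (\<exists>t. s t = Transmit i)}"
      using rs(2) s_slot by (auto simp: in_set_conv_nth) blast
    then have "card (set rs) \<le> throughput \<sigma> s"
      unfolding throughput_def by (intro card_mono) auto
    with rs(1) show ?thesis by (simp add: distinct_card)
  qed
  ultimately show ?thesis using throughput_le_OPT order_trans by blast
qed

text \<open>The converse estimate. As \<open>ts\<close> lists all transmissions between its ends,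
  the gaps between its entries are disjoint and free of transmissions. Each gap holds an integer
  number of transitions, hence at least the rounded distance.\<close>

lemma path_cost_le_transitions:
  assumes feas: "feasible w \<sigma> s"
    and "sorted_wrt (<) ts" "\<And>t. t \<in> set ts \<Longrightarrow> s t = Transmit (f t)"
    and "\<And>u p. hd ts \<le> u \<Longrightarrow> u \<le> last ts \<Longrightarrow> s u = Transmit p \<Longrightarrow> u \<in> set ts"
  shows "path_cost (\<lambda>a b. nat \<lceil>w a b\<rceil>) (map (\<lambda>t. color (\<sigma> ! f t)) ts)
    \<le> card {u. hd ts \<le> u \<and> u \<le> last ts \<and> s u = Transition}"
  using assms(2-4)
proof (induction ts rule: induct_list012)
  case (3 t t' ts)
  let ?d = "\<lambda>a b. nat \<lceil>w a b\<rceil>"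
  let ?l = "last (t' # ts)"
  have "t < t'" using 3 by simp
  have "t' \<le> ?l" using 3(3) by (cases ts rule: rev_cases) auto
  have gap: "s u \<noteq> Transmit k" if "t < u" "u < t'" for u k
  proof
    assume "s u = Transmit k"
    with that \<open>t' \<le> ?l\<close> have "u \<in> set (t # t' # ts)" by (intro 3(5)) auto
    with that 3(3) show False by auto
  qed
  have "s t = Transmit (f t)" "s t' = Transmit (f t')" by (auto intro: 3(4))
  with gap \<open>t < t'\<close> feas have "w (color (\<sigma> ! f t)) (color (\<sigma> ! f t'))
      \<le> real (card {u. t < u \<and> u < t' \<and> s u = Transition})"
    unfolding feasible_def by blast
  then have 1: "?d (color (\<sigma> ! f t)) (color (\<sigma> ! f t'))
      \<le> card {u. t < u \<and> u < t' \<and> s u = Transition}"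
    by (simp add: nat_le_iff ceiling_le_iff)
  have 2: "path_cost ?d (map (\<lambda>t. color (\<sigma> ! f t)) (t' # ts))
      \<le> card {u. hd (t' # ts) \<le> u \<and> u \<le> ?l \<and> s u = Transition}"
  proof (rule 3(2))
    fix u p assume u: "hd (t' # ts) \<le> u" "u \<le> ?l" "s u = Transmit p"
    then have "u \<in> set (t # t' # ts)" using \<open>t < t'\<close> by (intro 3(5)[of u p]) auto
    with u \<open>t < t'\<close> show "u \<in> set (t' # ts)" by auto
  qed (use 3 in auto)
  have "card {u. t < u \<and> u < t' \<and> s u = Transition}
      + card {u. hd (t' # ts) \<le> u \<and> u \<le> ?l \<and> s u = Transition}
      = card ({u. t < u \<and> u < t' \<and> s u = Transition}
        \<union> {u. hd (t' # ts) \<le> u \<and> u \<le> ?l \<and> s u = Transition})"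
    by (rule card_Un_disjoint[symmetric])
       (auto intro: finite_subset[of _ "{..t'}"] finite_subset[of _ "{..?l}"])
  also have "\<dots> \<le> card {u. hd (t # t' # ts) \<le> u \<and> u \<le> last (t # t' # ts) \<and> s u = Transition}"
    using \<open>t < t'\<close> \<open>t' \<le> ?l\<close>
    by (intro card_mono) (auto intro: finite_subset[of _ "{..?l}"])
  finally show ?case
    using 1 2 unfolding list.map path_cost.simps(1) by linarith
qed auto

section \<open>The adversary\<close>

lemma length_filter_replicate_upt:
  "length (filter P (concat (map (\<lambda>c. replicate (f c) c) [0..<n])))
    = (\<Sum>c<n. if P c then f c else 0)"
  by (induction n) auto

text \<open>
  Time is divided into \<open>N\<close> intervals of \<^term>\<open>2 * M\<close> slots each.  At the beginning there are
  enough packets of the root color to fill half of these slots, and \<^term>\<open>M\<close> packets of the other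
  colors arrive at the start of each interval, distributed over the colors in proportion to the
  lengths of the Prim edges.  After interval \<open>j\<close> this stops and a flood of packets fills all slots
  that are not needed for the initial packets.
\<close>

locale adversary =
  fixes C :: nat and w :: "nat \<Rightarrow> nat \<Rightarrow> real" and L N root :: nat
    and e :: "nat \<Rightarrow> nat" and ord :: "nat list"
  assumes metric: "Metric_space {..<C} w"
    and root: "root < C" "e root = 0"
    and walk: "set xs \<subseteq> {..<C} \<Longrightarrow> root \<in> set xs \<Longrightarrow>
      (\<Sum>c\<in>set xs. e c) \<le> path_cost (\<lambda>a b. nat \<lceil>w a b\<rceil>) xs"
    and tour: "distinct ord" "set ord = {..<C} - {root}"
      "path_cost (\<lambda>a b. nat \<lceil>w a b\<rceil>) (root # ord @ [root]) \<le> 2 * (\<Sum>c<C. e c)"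
    and positive: "0 < (\<Sum>c<C. e c)" "0 < N" "0 < L"
begin

text \<open>The \<open>N\<close> intervals have \<open>2 * F\<close> slots in total, and
  \<open>F\<close> is the number of initial packets as well as of batch packets in
  \<open>inp N\<close>. Batch packets expire at \<open>Y\<close>. \<open>D\<close> is the number of
  packets and also bounds all deadlines, so that a slot without transmission costs a packet.\<close>

definition W :: nat where "W = (\<Sum>c<C. e c)"
definition M :: nat where "M = N * W"
definition F :: nat where "F = N * M"
definition Y :: nat where "Y = 3 * F + L"
definition D :: nat where "D = Y + F"

definition batch :: "nat list" where
  "batch = concat (map (\<lambda>c. replicate (N * e c) c) [0..<C])"

text \<open>Packet 0 has the prescribed minimal laxity; all others may be more patient.\<close>

definition pk :: "nat \<Rightarrow> nat \<Rightarrow> packet" where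
  "pk j p = (if p = 0 then Packet 1 (Suc L) root
     else if p < F then Packet 1 D root
     else if p < F + j * M then Packet (Suc ((p - F) div M * (2 * M))) Y (batch ! ((p - F) mod M))
     else Packet (Suc (j * (2 * M))) (Y + j * M) root)"

definition inp :: "nat \<Rightarrow> packet list" where
  "inp j = map (pk j) [0..<D]"

lemma M_pos: "0 < M" using positive by (simp add: M_def W_def)

lemma F_pos: "0 < F" using M_pos positive by (simp add: F_def)

lemma le_F: "j \<le> N \<Longrightarrow> j * M \<le> F"
  by (simp add: F_def)

lemma length_inp [simp]: "length (inp j) = D" by (simp add: inp_def)

lemma nth_inp [simp]: "p < D \<Longrightarrow> inp j ! p = pk j p" by (simp add: inp_def)

lemma length_batch: "length batch = M"
  using length_filter_replicate_upt[of "\<lambda>_. True" "\<lambda>c. N * e c" C]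
  by (simp add: batch_def M_def W_def sum_distrib_left)

lemma card_batch_not_in:
  "card {k. k < M \<and> batch ! k \<notin> S} = (\<Sum>c<C. if c \<notin> S then N * e c else 0)"
  using length_filter_replicate_upt[of "\<lambda>c. c \<notin> S" "\<lambda>c. N * e c" C]
  by (simp only: length_filter_conv_card length_batch flip: batch_def)

lemma set_batch: "set batch \<subseteq> {..<C} - {root}"
  using root by (auto simp: batch_def)

lemma pk_initial: "p < F \<Longrightarrow> release (pk j p) = 1 \<and> color (pk j p) = root \<and> deadline (pk j p) \<le> D"
  using F_pos by (auto simp: pk_def D_def Y_def)

lemma pk_batch:
  assumes "F \<le> p" "p < F + j * M"
  shows "pk j p = Packet (Suc ((p - F) div M * (2 * M))) Y (batch ! ((p - F) mod M))"
    and "(p - F) div M < j" "color (pk j p) \<in> {..<C} - {root}"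
proof -
  show *: "pk j p = Packet (Suc ((p - F) div M * (2 * M))) Y (batch ! ((p - F) mod M))"
    using assms F_pos by (simp add: pk_def)
  show "(p - F) div M < j" using assms by (intro less_mult_imp_div_less) auto
  have "batch ! ((p - F) mod M) \<in> set batch" using M_pos by (simp add: length_batch)
  then show "color (pk j p) \<in> {..<C} - {root}" using set_batch * by auto
qed

lemma pk_flood: "F + j * M \<le> p \<Longrightarrow> pk j p = Packet (Suc (j * (2 * M))) (Y + j * M) root"
  using F_pos by (simp add: pk_def)

lemma pk_cases:
  obtains (initial) "p < F" | (batch) "F \<le> p" "p < F + j * M" | (flood) "F + j * M \<le> p"
  by linarith

lemma color_less: "color (pk j p) < C"
  by (cases rule: pk_cases[where p = p and j = j]) (use pk_initial pk_batch(3) pk_flood root in force)+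

lemma deadline_le: "j \<le> N \<Longrightarrow> deadline (pk j p) \<le> D"
  by (cases rule: pk_cases[where p = p and j = j])
     (use pk_initial pk_batch(1) pk_flood le_F[of j] in \<open>auto simp: D_def\<close>)

lemma release_le_batch:
  assumes "F \<le> p" "p < F + j * M"
  shows "release (pk j p) + 2 * M \<le> Suc (j * (2 * M))"
proof -
  have "Suc ((p - F) div M) * (2 * M) \<le> j * (2 * M)"
    using pk_batch(2)[OF assms] by (intro mult_le_mono1) simp
  then show ?thesis using pk_batch(1)[OF assms] by simp
qed

text \<open>Packet 0 attains the laxity \<open>L\<close>. All other deadlines are at least
  \<open>Y\<close>, whose summand \<open>3 * F\<close> is at least every release time.\<close>

lemma valid_input_inp:
  assumes "j \<le> N"
  shows "valid_input C L (inp j)"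
proof -
  have L_le: "L \<le> deadline (pk j p) - release (pk j p)" "1 \<le> release (pk j p)"
    "1 \<le> deadline (pk j p)" for p
  proof -
    have "1 \<le> release (pk j p) \<and> release (pk j p) + L \<le> deadline (pk j p)"
    proof (cases rule: pk_cases[where p = p and j = j])
      case initial
      then show ?thesis using F_pos by (auto simp: pk_def D_def Y_def)
    next
      case batch
      then show ?thesis
        using release_le_batch[OF batch] pk_batch(1)[OF batch] le_F[OF assms] M_pos
        by (simp add: Y_def)
    next
      case flood
      then show ?thesis
        using le_F[OF assms] F_pos by (simp add: pk_flood Y_def)
    qed
    then show "L \<le> deadline (pk j p) - release (pk j p)" "1 \<le> release (pk j p)"
      "1 \<le> deadline (pk j p)" by linarith+
  qed
  have "release (pk j p) \<le> release (pk j q)" if "p \<le> q" for p q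
  proof (cases rule: pk_cases[where p = q and j = j])
    case initial
    then show ?thesis using that pk_initial by simp
  next
    case batch
    show ?thesis
    proof (cases "p < F")
      case True
      then show ?thesis using L_le(2) pk_initial by simp
    next
      case False
      then show ?thesis
        using that batch pk_batch(1)[of p j] pk_batch(1)[OF batch] by (simp add: div_le_mono)
    qed
  next
    case flood
    then show ?thesis
      using release_le_batch[of p j] pk_initial[of p j] pk_flood[of j p] pk_flood[of j q]
      by (cases rule: pk_cases[where p = p and j = j]) auto
  qed
  then have "sorted (map release (inp j))"
    by (simp add: sorted_iff_nth_mono)
  moreover have "Min ((\<lambda>p. deadline p - release p) ` set (inp j)) = L"
  proof (rule Min_eqI)
    have "0 < D" using F_pos by (simp add: D_def)
    then have "pk j 0 \<in> set (inp j)" by (simp add: inp_def)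
    moreover have "deadline (pk j 0) - release (pk j 0) = L" by (simp add: pk_def)
    ultimately show "L \<in> (\<lambda>p. deadline p - release p) ` set (inp j)" by force
  qed (use L_le in \<open>auto simp: inp_def\<close>)
  moreover have "inp j \<noteq> []" using F_pos by (simp add: inp_def D_def)
  ultimately show ?thesis
    using L_le color_less by (auto simp: valid_input_def inp_def)
qed

text \<open>The two inputs agree below position \<open>F + j * M\<close>, and in both of them all
  further packets are released after slot \<open>j * (2 * M)\<close>. Until then the algorithm
  cannot tell whether the flood is about to come.\<close>

lemma schedule_of_prefix:
  assumes "j \<le> N" "t \<le> j * (2 * M)"
  shows "schedule_of A (inp j) t = schedule_of A (inp N) t"
proof -
  have agree: "release (pk j p) \<le> t \<and> pk j p = pk N p \<or> \<not> release (pk j p) \<le> t \<and> \<not> release (pk N p) \<le> t" for p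
  proof (cases "p < F + j * M")
    case True
    moreover have "j * M \<le> N * M" using assms by simp
    ultimately have "p < F + N * M" by linarith
    with True have "pk j p = pk N p" by (simp add: pk_def)
    then show ?thesis by simp
  next
    case False
    then have j: "release (pk j p) = Suc (j * (2 * M))" by (simp add: pk_flood)
    moreover have "Suc (j * (2 * M)) \<le> release (pk N p)"
    proof (cases "p < F + N * M")
      case True
      then have "p = F + (p - F)" "j * M \<le> p - F" using False by auto
      then have "j \<le> (p - F) div M" using M_pos by (simp add: less_eq_div_iff_mult_less_eq)
      then show ?thesis using pk_batch(1)[of p N] True False by (simp add: mult_le_mono1)
    next
      case False
      then show ?thesis using assms by (simp add: pk_flood mult_le_mono1)
    qed
    ultimately show ?thesis using assms by linarith
  qed
  have "filter (\<lambda>p. release (pk j p) \<le> t) [0..<D] = filter (\<lambda>p. release (pk N p) \<le> t) [0..<D]"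
    by (rule filter_cong[OF refl]) (use agree in force)
  moreover have "map (pk j) (filter (\<lambda>p. release (pk N p) \<le> t) [0..<D])
      = map (pk N) (filter (\<lambda>p. release (pk N p) \<le> t) [0..<D])"
    by (rule map_cong[OF refl]) (use agree in force)
  ultimately have "filter (\<lambda>p. release p \<le> t) (inp j) = filter (\<lambda>p. release p \<le> t) (inp N)"
    by (simp add: inp_def filter_map comp_def)
  then show ?thesis by (simp add: schedule_of_def)
qed

section \<open>Losses of an online algorithm\<close>

definition unserved :: "(nat \<Rightarrow> action) \<Rightarrow> nat \<Rightarrow> nat set" where
  "unserved s j = {p \<in> {F..<F + j * M}. \<forall>t\<le>j * (2 * M). s t \<noteq> Transmit p}"

text \<open>Transition slots count as idle, since only the missing transmission matters.\<close>

definition idle :: "(nat \<Rightarrow> action) \<Rightarrow> nat \<Rightarrow> nat set" where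
  "idle s i = {t \<in> {i * (2 * M)<..Suc i * (2 * M)}. \<forall>p. s t \<noteq> Transmit p}"

lemma finite_unserved [simp]: "finite (unserved s j)" by (simp add: unserved_def)

lemma finite_idle [simp]: "finite (idle s i)" by (simp add: idle_def)

context
  fixes j s
  assumes feas: "feasible w (inp j) s"
begin

lemma transmitD:
  assumes "s t = Transmit p"
  shows "p < D" "release (pk j p) \<le> t" "t \<le> deadline (pk j p)"
proof -
  have *: "p < length (inp j) \<and> release (inp j ! p) \<le> t \<and> t \<le> deadline (inp j ! p)"
    using feas assms unfolding feasible_def by blast
  then show "p < D" by simp
  with * show "release (pk j p) \<le> t" "t \<le> deadline (pk j p)" by simp_all
qed

lemma transmit_unique: "s t = Transmit p \<Longrightarrow> s t' = Transmit p \<Longrightarrow> t = t'"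
  using feas unfolding feasible_def by blast

lemma card_transmitted_le:
  assumes "finite T" "\<And>p. p \<in> P \<Longrightarrow> \<exists>t\<in>T. s t = Transmit p"
  shows "card P \<le> card T"
proof -
  from assms(2) obtain f where f: "\<And>p. p \<in> P \<Longrightarrow> f p \<in> T \<and> s (f p) = Transmit p" by metis
  then have "inj_on f P" by (intro inj_onI) (metis action.inject)
  then show ?thesis using assms(1) f by (intro card_inj_on_le[of f]) auto
qed

text \<open>After slot \<open>j * (2 * M)\<close> the backlog and the flood compete for the slots up
  to \<open>Y + j * M\<close>. These are \<open>Y - j * M\<close> slots, exactly as many as there
  are flood packets, so the backlog is a lower bound for the loss.\<close>

lemma throughput_unserved:
  assumes "j \<le> N"
  shows "throughput (inp j) s + card (unserved s j) \<le> D"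
proof -
  define S where "S = {p. p < D \<and> (\<exists>t. s t = Transmit p)}"
  define Q where "Q = unserved s j \<union> {F + j * M..<D}"
  have jM: "j * M \<le> F" "j * (2 * M) = j * M + j * M" using le_F[OF assms] by simp_all
  have fin: "finite S" "finite Q" by (simp_all add: S_def Q_def)
  have "card Q = card (unserved s j) + (Y - j * M)"
    unfolding Q_def using jM by (subst card_Un_disjoint) (auto simp: unserved_def D_def)
  moreover have "card (S \<inter> Q) \<le> card {j * (2 * M)<..Y + j * M}"
  proof (rule card_transmitted_le)
    fix p assume p: "p \<in> S \<inter> Q"
    then obtain t where t: "s t = Transmit p" by (auto simp: S_def)
    have "j * (2 * M) < t \<and> t \<le> Y + j * M"
    proof (cases "p \<in> unserved s j")
      case True
      then have "j * (2 * M) < t"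
        using t unfolding unserved_def mem_Collect_eq by (meson leI)
      moreover have "deadline (pk j p) = Y" using True pk_batch(1)[of p j] by (auto simp: unserved_def)
      ultimately show ?thesis using transmitD(3)[OF t] by simp
    next
      case False
      then show ?thesis using p transmitD(2,3)[OF t] pk_flood[of j p] by (simp add: Q_def)
    qed
    with t show "\<exists>t\<in>{j * (2 * M)<..Y + j * M}. s t = Transmit p" by auto
  qed simp
  moreover have sub: "Q \<subseteq> {..<D}" using jM by (auto simp: Q_def unserved_def D_def Y_def)
  have "card (S - Q) \<le> card ({..<D} - Q)" by (intro card_mono) (auto simp: S_def)
  then have "card (S - Q) \<le> D - card Q" using sub fin by (simp add: card_Diff_subset)
  moreover have "card Q \<le> D" using card_mono[OF _ sub] by simp
  moreover have "card S = card (S \<inter> Q) + card (S - Q)"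
    using fin by (metis card_Int_Diff)
  moreover have "throughput (inp j) s = card S" by (simp add: throughput_def S_def)
  ultimately show ?thesis using jM by simp
qed

end

text \<open>All deadlines are at most \<open>D\<close>, so only the slots from 1 to \<open>D\<close>
  can carry packets, and every idle one among them is missing.\<close>

lemma throughput_idle:
  assumes feas: "feasible w (inp N) s"
  shows "throughput (inp N) s + (\<Sum>i<N. card (idle s i)) \<le> D"
proof -
  let ?I = "\<Union>i<N. idle s i"
  have disj: "idle s i \<inter> idle s i' = {}" if "i < i'" for i i'
  proof -
    have "Suc i * (2 * M) \<le> i' * (2 * M)" using that by (intro mult_le_mono1) simp
    then show ?thesis by (auto simp: idle_def)
  qed
  have "idle s i \<inter> idle s i' = {}" if "i \<noteq> i'" for i i'
    using disj[of i i'] disj[of i' i] that by (cases "i < i'") auto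
  then have card_I: "card ?I = (\<Sum>i<N. card (idle s i))"
    by (intro card_UN_disjoint) auto
  have sub: "?I \<subseteq> {1..D}"
  proof
    fix t assume "t \<in> ?I"
    then obtain i where "i < N" "i * (2 * M) < t" "t \<le> Suc i * (2 * M)" by (auto simp: idle_def)
    moreover from this have "Suc i * (2 * M) \<le> N * (2 * M)" by (intro mult_le_mono1) simp
    ultimately show "t \<in> {1..D}" by (auto simp: D_def Y_def F_def)
  qed
  have "throughput (inp N) s \<le> card ({1..D} - ?I)"
    unfolding throughput_def
  proof (rule card_transmitted_le[OF feas])
    fix p assume "p \<in> {p. p < length (inp N) \<and> (\<exists>t. s t = Transmit p)}"
    then obtain t where t: "s t = Transmit p" by blast
    have "1 \<le> release (pk N p)"
      using pk_initial pk_batch(1) pk_flood by (cases rule: pk_cases[where p = p and j = N]) auto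
    then have "t \<in> {1..D} - ?I"
      using transmitD[OF feas t] t deadline_le[of N p] by (auto simp: idle_def)
    with t show "\<exists>t\<in>{1..D} - ?I. s t = Transmit p" by blast
  qed simp
  also have "\<dots> = D - card ?I"
    using sub by (subst card_Diff_subset) (auto intro: finite_subset)
  finally show ?thesis
    using card_mono[OF _ sub] card_I by simp
qed

text \<open>
  Within an interval the schedule stays away from the root color, visits few colors, or spends
  many slots on transitions.
\<close>

lemma interval_loss:
  assumes feas: "feasible w (inp N) s" and i: "i < N"
  shows "M \<le> card (unserved s i) + card (unserved s (Suc i)) + N * card (idle s i)"
proof -
  define I where "I = {i * (2 * M)<..Suc i * (2 * M)}"
  have le_N: "Suc i * (2 * M) \<le> N * (2 * M)" "Suc i * M \<le> N * M"
    using i by (auto intro!: mult_le_mono1 simp del: mult_Suc)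
  \<comment> \<open>In \<open>inp N\<close> the flood comes only after the last interval, so the
    root color is visited here only for initial packets.\<close>
  have no_flood: "p < F + N * M" if "s t = Transmit p" "t \<in> I" for t p
    using transmitD(2)[OF feas that(1)] that(2) le_N pk_flood[of N p]
    by (cases "p < F + N * M") (auto simp: I_def)
  have batch_lt: "p < F + Suc i * M" if t: "s t = Transmit p" "t \<in> I" and p: "F \<le> p" for t p
  proof -
    have "(p - F) div M * (2 * M) < Suc i * (2 * M)"
      using pk_batch(1)[OF p no_flood[OF t]] transmitD(2)[OF feas t(1)] t(2) by (auto simp: I_def)
    then have "(p - F) div M < Suc i" by (metis mult_less_cancel2)
    then have "p - F < Suc i * M" using M_pos by (simp only: div_less_iff_less_mult)
    then show ?thesis using p by linarith
  qed
  show ?thesis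
  proof (cases "\<exists>t\<in>I. \<exists>p<F. s t = Transmit p")
    case True
    \<comment> \<open>An initial packet is sent, so the walk of this interval meets the root, and
      the visited colors cost at least the sum of their \<open>e c\<close> in idle slots. Every
      missed color leaves its \<open>N * e c\<close> new packets unserved. With the factor
      \<open>N\<close> on the idle slots both parts add up to \<open>M = N * W\<close>.\<close>
    then obtain t0 p0 where t0: "t0 \<in> I" "p0 < F" "s t0 = Transmit p0" by blast
    define f where "f t = (THE p. s t = Transmit p)" for t
    have f: "s t = Transmit (f t)" if "s t = Transmit p" for t p
      using that by (simp add: f_def)
    define ts where "ts = filter (\<lambda>t. \<exists>p. s t = Transmit p) [Suc (i * (2 * M))..<Suc (Suc i * (2 * M))]"
    have set_ts: "set ts = {t \<in> I. \<exists>p. s t = Transmit p}" by (auto simp: ts_def I_def)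
    define cs where "cs = map (\<lambda>t. color (inp N ! f t)) ts"
    have "t0 \<in> set ts" using t0 set_ts by auto
    then have "ts \<noteq> []" by auto
    then have in_I: "hd ts \<in> I" "last ts \<in> I" using set_ts hd_in_set last_in_set by blast+
    have f_less: "f t < D" if "t \<in> set ts" for t
      using that set_ts f transmitD(1)[OF feas] by blast
    have cs_sub: "set cs \<subseteq> {..<C}" using f_less color_less by (auto simp: cs_def)
    have "f t0 = p0" using t0 by (simp add: f_def)
    then have "root \<in> set cs"
      using \<open>t0 \<in> set ts\<close> f_less[of t0] pk_initial[OF t0(2), of N] unfolding cs_def by force
    with cs_sub have "(\<Sum>c\<in>set cs. e c) \<le> path_cost (\<lambda>a b. nat \<lceil>w a b\<rceil>) cs" by (rule walk)
    also have "\<dots> \<le> card {u. hd ts \<le> u \<and> u \<le> last ts \<and> s u = Transition}"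
      unfolding cs_def
    proof (rule path_cost_le_transitions[OF feas])
      show "sorted_wrt (<) ts" unfolding ts_def by (intro sorted_wrt_filter) (rule sorted_wrt_upt)
      show "s t = Transmit (f t)" if "t \<in> set ts" for t using that set_ts f by blast
      show "u \<in> set ts" if "hd ts \<le> u" "u \<le> last ts" "s u = Transmit p" for u p
        using that in_I unfolding set_ts by (auto simp: I_def)
    qed
    also have "\<dots> \<le> card (idle s i)"
      using in_I by (intro card_mono) (auto simp: idle_def I_def)
    finally have walk_le: "(\<Sum>c\<in>set cs. e c) \<le> card (idle s i)" .
    have "(\<lambda>k. F + i * M + k) ` {k. k < M \<and> batch ! k \<notin> set cs} \<subseteq> unserved s (Suc i)"
    proof
      fix p assume "p \<in> (\<lambda>k. F + i * M + k) ` {k. k < M \<and> batch ! k \<notin> set cs}"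
      then obtain k where k: "k < M" "batch ! k \<notin> set cs" "p = F + i * M + k" by blast
      then have p: "F \<le> p" "p < F + Suc i * M" "p < F + N * M" using le_N by auto
      have pk: "pk N p = Packet (Suc (i * (2 * M))) Y (batch ! k)"
        using pk_batch(1)[OF p(1,3)] k by simp
      have "s t \<noteq> Transmit p" if "t \<le> Suc i * (2 * M)" for t
      proof
        assume t: "s t = Transmit p"
        then have "t \<in> I" using transmitD(2)[OF feas t] that pk by (simp add: I_def)
        then have "t \<in> set ts" "f t = p" using t by (auto simp: set_ts f_def)
        then have "batch ! k \<in> set cs" using f_less[of t] pk by (force simp: cs_def)
        with k show False by simp
      qed
      with p show "p \<in> unserved s (Suc i)" by (simp add: unserved_def)
    qed
    then have "card {k. k < M \<and> batch ! k \<notin> set cs} \<le> card (unserved s (Suc i))"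
      by (intro card_inj_on_le[where f = "\<lambda>k. F + i * M + k"]) (auto intro: inj_onI)
    moreover have "M = (\<Sum>c<C. if c \<notin> set cs then N * e c else 0) + N * (\<Sum>c\<in>set cs. e c)"
    proof -
      have "M = (\<Sum>c<C. (if c \<notin> set cs then N * e c else 0) + (if c \<in> set cs then N * e c else 0))"
        unfolding M_def W_def sum_distrib_left by (intro sum.cong) auto
      also have "\<dots> = (\<Sum>c<C. if c \<notin> set cs then N * e c else 0)
          + (\<Sum>c<C. if c \<in> set cs then N * e c else 0)"
        by (rule sum.distrib)
      also have "(\<Sum>c<C. if c \<in> set cs then N * e c else 0) = (\<Sum>c\<in>set cs. N * e c)"
        using cs_sub by (simp add: sum.inter_restrict[symmetric] Int_absorb1)
      finally show ?thesis by (simp add: sum_distrib_left)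
    qed
    ultimately show ?thesis
      using card_batch_not_in[of "set cs"] mult_le_mono2[OF walk_le, of N] by linarith
  next
    case False
    \<comment> \<open>Without initial packets only the backlog and the \<open>M\<close> packets of
      the new batch can fill the \<open>2 * M\<close> slots.\<close>
    have "I - idle s i \<subseteq> I" "finite I" "idle s i \<subseteq> I" by (auto simp: I_def idle_def)
    define P where "P = unserved s i \<union> {F + i * M..<F + Suc i * M}"
    have "card (I - idle s i) \<le> card P"
    proof -
      have "\<exists>p\<in>P. s t = Transmit p" if "t \<in> I - idle s i" for t
      proof -
        from that obtain p where p: "s t = Transmit p" "t \<in> I" by (auto simp: idle_def I_def)
        then have "F \<le> p" using False by (meson linorder_not_less)
        then have lt: "p < F + Suc i * M" by (rule batch_lt[OF p])
        have "p \<in> P"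
        proof (cases "F + i * M \<le> p")
          case False
          have "s t' \<noteq> Transmit p" if "t' \<le> i * (2 * M)" for t'
            using transmit_unique[OF feas p(1), of t'] that p(2) by (auto simp: I_def)
          then show ?thesis using False \<open>F \<le> p\<close> by (simp add: P_def unserved_def)
        qed (use lt in \<open>simp add: P_def\<close>)
        with p show ?thesis by blast
      qed
      then obtain g where g: "\<And>t. t \<in> I - idle s i \<Longrightarrow> g t \<in> P \<and> s t = Transmit (g t)" by metis
      then have "inj_on g (I - idle s i)"
        by (intro inj_onI) (metis transmit_unique[OF feas])
      moreover have "g ` (I - idle s i) \<subseteq> P" using g by blast
      moreover have "finite P" by (simp add: P_def)
      ultimately show ?thesis by (rule card_inj_on_le)
    qed
    also have "card P \<le> card (unserved s i) + M"
      unfolding P_def by (rule order_trans[OF card_Un_le]) simp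
    finally have "card I - card (idle s i) \<le> card (unserved s i) + M"
      using \<open>idle s i \<subseteq> I\<close> by (simp add: card_Diff_subset)
    moreover have "card I = 2 * M" by (simp add: I_def)
    moreover have "card (idle s i) \<le> N * card (idle s i)" using positive by simp
    ultimately show ?thesis by linarith
  qed
qed

text \<open>Sum \<open>interval_loss\<close> over all intervals. Each backlog enters for two
  adjacent intervals, hence the factor 2. By \<open>schedule_of_prefix\<close> the backlog of
  interval \<open>j\<close> is the same on \<open>inp j\<close>, where it is lost; the idle slots
  are lost on \<open>inp N\<close>.\<close>

lemma total_loss:
  assumes A: "online_algorithm C w L A"
  shows "N * M \<le> 2 * (\<Sum>j\<in>{1..N}. D - ALG A (inp j)) + N * (D - ALG A (inp N))"
proof -
  define s where "s = schedule_of A (inp N)"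
  have feas: "feasible w (inp j) (schedule_of A (inp j))" if "j \<le> N" for j
    using A valid_input_inp[OF that] by (simp add: online_algorithm_def)
  have feas_s: "feasible w (inp N) s" using feas by (simp add: s_def)
  have unserved: "card (unserved s j) \<le> D - ALG A (inp j)" if "j \<le> N" for j
  proof -
    have "unserved s j = unserved (schedule_of A (inp j)) j"
      using schedule_of_prefix[OF that, of _ A] by (auto simp: unserved_def s_def)
    then show ?thesis using throughput_unserved[OF feas that] that by (simp add: ALG_def)
  qed
  have idle: "(\<Sum>i<N. card (idle s i)) \<le> D - ALG A (inp N)"
    using throughput_idle[OF feas_s] by (simp add: ALG_def s_def)
  have "N * M \<le> (\<Sum>i<N. card (unserved s i) + card (unserved s (Suc i)) + N * card (idle s i))"
    using sum_mono[of "{..<N}" "\<lambda>_. M"] interval_loss[OF feas_s] by simp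
  also have "\<dots> = (\<Sum>i<N. card (unserved s i)) + (\<Sum>i<N. card (unserved s (Suc i)))
      + N * (\<Sum>i<N. card (idle s i))"
    by (simp add: sum.distrib sum_distrib_left)
  also have "(\<Sum>i<N. card (unserved s (Suc i))) = (\<Sum>j\<in>{1..N}. card (unserved s j))"
    by (rule sum.reindex_bij_witness[of _ "\<lambda>j. j - 1" Suc]) auto
  also have "(\<Sum>i<N. card (unserved s i)) \<le> (\<Sum>j\<in>{1..N}. card (unserved s j))"
  proof -
    have "unserved s 0 = {}" by (simp add: unserved_def)
    then have "(\<Sum>i<N. card (unserved s i)) = (\<Sum>i\<in>{1..<N}. card (unserved s i))"
      using positive by (intro sum.mono_neutral_right) (auto simp: not_less_eq_eq)
    also have "\<dots> \<le> (\<Sum>j\<in>{1..N}. card (unserved s j))" by (intro sum_mono2) auto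
    finally show ?thesis .
  qed
  also have "(\<Sum>j\<in>{1..N}. card (unserved s j)) \<le> (\<Sum>j\<in>{1..N}. D - ALG A (inp j))"
    using unserved by (intro sum_mono) auto
  finally show ?thesis using mult_le_mono2[OF idle, of N] by linarith
qed

end

section \<open>Tours of an optimal schedule\<close>

lemma path_cost_replicate:
  "d c c = 0 \<Longrightarrow> path_cost d (c # replicate k c @ xs) = path_cost d (c # xs)"
  by (induction k) auto

lemma path_cost_insert:
  fixes d :: "'a \<Rightarrow> 'a \<Rightarrow> nat"
  assumes "\<And>a b c. a \<in> V \<Longrightarrow> b \<in> V \<Longrightarrow> c \<in> V \<Longrightarrow> d a c \<le> d a b + d b c"
    and "set (xs @ x # ys) \<subseteq> V"
  shows "path_cost d (xs @ ys) \<le> path_cost d (xs @ x # ys)"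
  using assms(2)
proof (induction xs rule: induct_list012)
  case 1
  show ?case by (cases ys) auto
next
  case (2 a)
  then show ?case using assms(1)[of a x "hd ys"] by (cases ys) auto
qed auto

text \<open>Repeating a color is free, and omitting one, the case \<open>k c = 0\<close>, is a
  shortcut by the triangle inequality.\<close>

lemma path_cost_concat_replicate:
  fixes d :: "'a \<Rightarrow> 'a \<Rightarrow> nat"
  assumes tri: "\<And>a b c. a \<in> V \<Longrightarrow> b \<in> V \<Longrightarrow> c \<in> V \<Longrightarrow> d a c \<le> d a b + d b c"
    and refl: "\<And>a. a \<in> V \<Longrightarrow> d a a = 0"
    and "a \<in> V" "set xs \<subseteq> V" "set ys \<subseteq> V"
  shows "path_cost d (a # concat (map (\<lambda>c. replicate (k c) c) xs) @ ys) \<le> path_cost d (a # xs @ ys)"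
  using assms(3-)
proof (induction xs arbitrary: a)
  case (Cons x xs)
  show ?case
  proof (cases "k x")
    case 0
    have "path_cost d (a # concat (map (\<lambda>c. replicate (k c) c) xs) @ ys)
        \<le> path_cost d (a # xs @ ys)"
      using Cons by simp
    also have "\<dots> \<le> path_cost d (a # x # xs @ ys)"
      using path_cost_insert[of V d "[a]" x "xs @ ys", OF tri] Cons.prems by simp
    finally show ?thesis using 0 by simp
  next
    case (Suc n)
    have "path_cost d (x # concat (map (\<lambda>c. replicate (k c) c) xs) @ ys)
        \<le> path_cost d (x # xs @ ys)"
      using Cons by simp
    then show ?thesis
      using Suc Cons.prems refl[of x] path_cost_replicate[of d x n] by simp
  qed
qed simp

section \<open>The offline schedule for a known stopping time\<close>

context adversary
begin

abbreviation dst :: "nat \<Rightarrow> nat \<Rightarrow> nat" where "dst a b \<equiv> nat \<lceil>w a b\<rceil>"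

abbreviation col :: "nat \<Rightarrow> nat \<Rightarrow> nat" where "col j p \<equiv> color (pk j p)"

lemma dst_refl: "a < C \<Longrightarrow> dst a a = 0"
  using nat_ceiling_metric(2)[OF metric, of a] by simp

lemma dst_triangle: "a \<in> {..<C} \<Longrightarrow> b \<in> {..<C} \<Longrightarrow> c \<in> {..<C} \<Longrightarrow> dst a c \<le> dst a b + dst b c"
  by (rule nat_ceiling_metric(3)[OF metric])

text \<open>Sorting the packets of a block of batches by color, in the order \<open>ord\<close>,
  serves the whole block in a single closed tour.\<close>

lemma tour_exists:
  assumes b: "b \<le> b'" "b' \<le> j"
  shows "\<exists>rs. distinct rs \<and> set rs = {F + b * M..<F + b' * M} \<and>
    path_cost dst (root # map (col j) rs @ [root]) \<le> 2 * W"
proof -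
  define ps where "ps = [F + b * M..<F + b' * M]"
  define rs where "rs = concat (map (\<lambda>c. filter (\<lambda>p. col j p = c) ps) ord)"
  have "b' * M \<le> j * M" using b by simp
  then have "col j p \<in> set ord" if "p \<in> set ps" for p
  proof -
    have "F + b * M \<le> p" "p < F + b' * M" using that by (simp_all add: ps_def)
    with \<open>b' * M \<le> j * M\<close> have "F \<le> p" "p < F + j * M" by linarith+
    then show ?thesis using pk_batch(3) by (simp add: tour(2))
  qed
  then have "set rs = set ps" by (auto simp: rs_def)
  moreover have "distinct rs"
  proof -
    have "distinct (concat (map (\<lambda>c. filter (\<lambda>p. col j p = c) ps) cs))" if "distinct cs" for cs
      using that by (induction cs) (auto simp: ps_def)
    then show ?thesis using tour(1) by (simp add: rs_def)
  qed
  moreover have "map (col j) (filter (\<lambda>p. col j p = c) ps)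
      = replicate (length (filter (\<lambda>p. col j p = c) ps)) c" for c
    by (rule replicate_eqI) auto
  then have "map (col j) rs
      = concat (map (\<lambda>c. replicate (length (filter (\<lambda>p. col j p = c) ps)) c) ord)"
    by (simp add: rs_def map_concat comp_def)
  then have "path_cost dst (root # map (col j) rs @ [root]) \<le> path_cost dst (root # ord @ [root])"
    using path_cost_concat_replicate[of "{..<C}" dst root ord "[root]", OF dst_triangle dst_refl]
      root tour(2) by auto
  ultimately show ?thesis using tour(3) by (auto simp: ps_def W_def)
qed

text \<open>
  Each tour serves all batches that will have arrived when it starts, so that the number of
  batches that are left is halved by every tour.
\<close>

lemma tours_exist:
  assumes "b \<le> j" "j - b < 2 ^ m"
  shows "\<exists>rs. distinct rs \<and> set rs = {F + b * M..<F + j * M} \<and>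
    path_cost dst (root # map (col j) rs @ [root]) \<le> m * (2 * W) \<and>
    (\<forall>r<length rs. release (pk j (rs ! r)) \<le> Suc ((j + b) * M + r))"
  using assms
proof (induction m arbitrary: b)
  case 0
  then show ?case using dst_refl[OF root(1)] by (intro exI[of _ "[]"]) auto
next
  case (Suc m)
  show ?case
  proof (cases "b = j")
    case True
    then show ?thesis using dst_refl[OF root(1)] by (intro exI[of _ "[]"]) auto
  next
    case False
    \<comment> \<open>This tour starts after at least \<open>(j + b) * M\<close> slots, when the
      batches \<open>i \<le> (j + b) div 2\<close> have arrived, since batch \<open>i\<close> comes
      after \<open>2 * i * M\<close> slots. Its \<open>b' - b\<close> batches move the start of the
      next tour to \<open>(j + b') * M\<close>. Transitions only delay packets, so they can be
      ignored for the release times.\<close>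
    define b' where "b' = Suc ((j + b) div 2)"
    have b': "b < b'" "b' \<le> j" "j - b' < 2 ^ m"
      using False Suc.prems by (auto simp: b'_def)
    obtain rs' where rs': "distinct rs'" "set rs' = {F + b' * M..<F + j * M}"
      "path_cost dst (root # map (col j) rs' @ [root]) \<le> m * (2 * W)"
      "\<And>r. r < length rs' \<Longrightarrow> release (pk j (rs' ! r)) \<le> Suc ((j + b') * M + r)"
      using Suc.IH[OF b'(2,3)] by blast
    obtain rs where rs: "distinct rs" "set rs = {F + b * M..<F + b' * M}"
      "path_cost dst (root # map (col j) rs @ [root]) \<le> 2 * W"
      using tour_exists[of b b' j] b' by auto
    have mult: "b * M \<le> b' * M" "b' * M \<le> j * M" using b' by simp_all
    have "length rs = b' * M - b * M"
      using rs(1,2) distinct_card[of rs] by simp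
    with mult(1) have len: "length rs + b * M = b' * M" by linarith
    show ?thesis
    proof (intro exI[of _ "rs @ rs'"] conjI allI impI)
      show "distinct (rs @ rs')" using rs rs' by auto
      show "set (rs @ rs') = {F + b * M..<F + j * M}"
        unfolding set_append rs(2) rs'(2) by (intro ivl_disj_un_two(3) add_left_mono mult)
      have "path_cost dst ((root # map (col j) rs) @ map (col j) rs' @ [root])
          \<le> path_cost dst ((root # map (col j) rs) @ root # map (col j) rs' @ [root])"
        using root color_less by (intro path_cost_insert[of "{..<C}"] dst_triangle) auto
      also have "\<dots> = path_cost dst ((root # map (col j) rs) @ [root])
          + path_cost dst (root # map (col j) rs' @ [root])"
        by (rule path_cost_append)
      finally show "path_cost dst (root # map (col j) (rs @ rs') @ [root]) \<le> Suc m * (2 * W)"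
        using rs(3) rs'(3) by simp
    next
      fix r assume r: "r < length (rs @ rs')"
      show "release (pk j ((rs @ rs') ! r)) \<le> Suc ((j + b) * M + r)"
      proof (cases "r < length rs")
        case True
        define p where "p = rs ! r"
        have "p \<in> set rs" using True by (simp add: p_def)
        then have "F + b * M \<le> p" "p < F + b' * M" unfolding rs(2) by auto
        with mult have p: "F \<le> p" "p < F + b' * M" "p < F + j * M" by linarith+
        have "(p - F) div M < b'" by (intro less_mult_imp_div_less) (use p in linarith)
        then have "(p - F) div M * 2 \<le> j + b" by (simp add: b'_def)
        then have "(p - F) div M * 2 * M \<le> (j + b) * M" by (rule mult_le_mono1)
        then have "(p - F) div M * (2 * M) \<le> (j + b) * M" unfolding mult.assoc .
        then have "release (pk j p) \<le> Suc ((j + b) * M + r)"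
          unfolding pk_batch(1)[OF p(1,3)] packet.sel by linarith
        then show ?thesis using True by (simp add: nth_append p_def)
      next
        case False
        define r' where "r' = r - length rs"
        have "r = length rs + r'" using False by (simp add: r'_def)
        then have "(j + b') * M + r' = (j + b) * M + r" using len by (simp add: add_mult_distrib)
        moreover have "r' < length rs'" using r False by (simp add: r'_def)
        ultimately show ?thesis using rs'(4)[of r'] False by (simp add: nth_append r'_def)
      qed
    qed
  qed
qed

text \<open>The schedule sends \<open>j * M\<close> initial packets, with packet 0 in slot 1 because
  of its short deadline, then the tours, then the flood, then the other initial packets, which last
  until \<open>D\<close>. Giving up the last \<open>X\<close> flood packets makes room for all
  transitions.\<close>

lemma OPT_inp_ge:
  assumes j: "1 \<le> j" "j \<le> N" and m: "N < 2 ^ m" "2 * m \<le> N"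
  shows "D \<le> OPT w (inp j) + m * (2 * W)"
proof -
  define X where "X = m * (2 * W)"
  obtain rs where rs: "distinct rs" "set rs = {F..<F + j * M}"
    "path_cost dst (root # map (col j) rs @ [root]) \<le> X"
    "\<And>r. r < length rs \<Longrightarrow> release (pk j (rs ! r)) \<le> Suc (j * M + r)"
    using tours_exist[of 0 j m] assms by (auto simp: X_def)
  have len: "length rs = j * M" using distinct_card[OF rs(1)] rs(2) by simp
  have jM: "j * M \<le> F" "0 < j * M" using le_F[OF j(2)] M_pos j(1) by simp_all
  have "X \<le> N * W" using mult_le_mono1[OF m(2), of W] by (simp add: X_def mult_ac)
  also have "\<dots> \<le> F" using positive by (simp add: F_def M_def)
  finally have X: "X \<le> F" .
  have D: "D = 4 * F + L" by (simp add: D_def Y_def)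
  define rest where "rest = [F + j * M..<D - X] @ [j * M..<F]"
  define qs where "qs = [0..<j * M] @ rs @ rest"
  have rest: "p \<notin> {F..<F + j * M}" "p < D" if "p \<in> set rest" for p
    using that X D by (auto simp: rest_def)
  have rest_root: "map (col j) rest = replicate (length rest) root"
  proof (rule replicate_eqI)
    fix y assume "y \<in> set (map (col j) rest)"
    then obtain p where p: "p \<in> set rest" "y = col j p" by auto
    from p(1) have "p < F \<or> F + j * M \<le> p" by (auto simp: rest_def)
    then show "y = root" using pk_initial pk_flood p(2) by auto
  qed simp
  have first_root: "map (col j) [0..<j * M] = replicate (j * M) root"
    using jM pk_initial by (intro replicate_eqI) auto
  have length_qs: "length qs = D - X"
    using len jM X D by (simp add: qs_def rest_def)
  have map_qs: "map (\<lambda>i. color (inp j ! i)) qs = map (col j) qs"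
    using rs(2) rest jM D by (intro map_cong) (auto simp: qs_def)
  have cost: "path_cost dst (map (col j) qs) \<le> X"
  proof -
    let ?R = "map (col j) rs"
    have V: "set ?R \<subseteq> {..<C}" using color_less by auto
    have "path_cost dst (map (col j) qs)
        = path_cost dst (replicate (j * M) root @ ?R @ replicate (length rest) root)"
      by (simp add: qs_def first_root rest_root)
    also have "\<dots> \<le> path_cost dst ((replicate (j * M) root @ ?R) @ root # replicate (length rest) root)"
      using path_cost_insert[of "{..<C}" dst "replicate (j * M) root @ ?R" root
          "replicate (length rest) root", OF dst_triangle] V root
      by (simp add: set_replicate_conv_if)
    also have "\<dots> = path_cost dst ((replicate (j * M) root @ ?R) @ [root])
        + path_cost dst (root # replicate (length rest) root)"
      by (rule path_cost_append)
    also have "path_cost dst (root # replicate (length rest) root) = 0"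
      using path_cost_replicate[of dst root "length rest" "[]"] dst_refl[OF root(1)] by simp
    also have "path_cost dst ((replicate (j * M) root @ ?R) @ [root])
        = path_cost dst (root # replicate (j * M - 1) root @ ?R @ [root])"
      using jM(2) by (cases "j * M") (auto simp: replicate_append_same)
    also have "\<dots> = path_cost dst (root # ?R @ [root])"
      using path_cost_replicate[of dst root] dst_refl[OF root(1)] by simp
    finally show ?thesis using rs(3) by simp
  qed
  have "length qs \<le> OPT w (inp j)"
  proof (rule length_le_OPT)
    show "distinct qs" using rs(1,2) rest jM by (auto simp: qs_def rest_def)
    show "set qs \<subseteq> {..<length (inp j)}" using rs(2) rest jM D by (auto simp: qs_def)
    fix r assume r: "r < length qs"
    define slot where "slot = Suc (r + path_cost dst (take (Suc r) (map (\<lambda>i. color (inp j ! i)) qs)))"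
    have slot: "Suc r \<le> slot" "slot \<le> Suc r + X"
      using path_cost_take_le[of dst "Suc r" "map (col j) qs"] cost by (simp_all add: slot_def map_qs)
    have "qs ! r < D" using nth_mem[OF r] rs(2) rest jM D by (auto simp: qs_def)
    then have nth: "inp j ! (qs ! r) = pk j (qs ! r)" by simp
    have rD: "Suc r + X \<le> D" using r length_qs by simp
    \<comment> \<open>The cases follow the blocks of \<open>qs\<close>. In the third one
      \<open>X \<le> F\<close> ensures that the tours end before the batches expire.\<close>
    consider "r = 0" | "0 < r" "r < j * M" | "j * M \<le> r" "r < j * M + j * M"
      | "j * M + j * M \<le> r" "r + F + X < D + j * M" | "D + j * M \<le> r + F + X"
      by linarith
    then have "release (pk j (qs ! r)) \<le> slot \<and> slot \<le> deadline (pk j (qs ! r))"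
    proof cases
      case 1
      then have "slot = 1" by (cases qs) (simp_all add: slot_def)
      moreover have "qs ! r = 0" using 1 jM by (simp add: qs_def nth_append)
      ultimately show ?thesis by (simp add: pk_def)
    next
      case 2
      then have "pk j (qs ! r) = Packet 1 D root" using jM by (simp add: qs_def nth_append pk_def)
      then show ?thesis using slot rD by simp
    next
      case 3
      define r' where "r' = r - j * M"
      have r': "r = j * M + r'" "r' < length rs" using 3 len by (auto simp: r'_def)
      then have qs_r: "qs ! r = rs ! r'" by (simp add: qs_def nth_append)
      then have "qs ! r \<in> {F..<F + j * M}" using rs(2) nth_mem[OF r'(2)] by (simp only: qs_r)
      then have "deadline (pk j (qs ! r)) = Y" using pk_batch(1)[of "qs ! r" j] by simp
      then show ?thesis using rs(4)[OF r'(2)] r'(1) qs_r slot 3 jM X by (simp add: Y_def)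
    next
      case 4
      define r' where "r' = r - (j * M + j * M)"
      have r': "r = length ([0..<j * M] @ rs) + r'" "r' < D - X - (F + j * M)"
        using 4 len X D by (auto simp: r'_def)
      then have "qs ! r = F + j * M + r'"
        unfolding qs_def append_assoc[symmetric] rest_def
        by (simp only: nth_append_length_plus append.assoc) (simp add: nth_append)
      then have "qs ! r = r + F - j * M" using r'(1) len by simp
      then have "pk j (qs ! r) = Packet (Suc (j * (2 * M))) (Y + j * M) root"
        using 4 by (intro pk_flood[THEN trans]) auto
      then show ?thesis using slot 4 by (simp add: D_def)
    next
      case 5
      have "length ([0..<j * M] @ rs @ [F + j * M..<D - X]) \<le> r"
        using 5 len X D jM by simp
      then have "qs ! r \<in> set [j * M..<F]"
        using r nth_append_right[of "[0..<j * M] @ rs @ [F + j * M..<D - X]" r "[j * M..<F]"]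
        by (auto simp: qs_def rest_def simp del: upt_Suc intro!: nth_mem)
      then have "0 < qs ! r" "qs ! r < F"
        using jM(2) unfolding set_upt atLeastLessThan_iff by linarith+
      then have "pk j (qs ! r) = Packet 1 D root" by (simp add: pk_def)
      then show ?thesis using slot rD by simp
    qed
    then show "release (inp j ! (qs ! r)) \<le> Suc (r + path_cost dst (take (Suc r) (map (\<lambda>i. color (inp j ! i)) qs)))
        \<and> Suc (r + path_cost dst (take (Suc r) (map (\<lambda>i. color (inp j ! i)) qs))) \<le> deadline (inp j ! (qs ! r))"
      by (simp add: nth slot_def)
  qed
  then show ?thesis using length_qs by (simp add: X_def)
qed

end

section \<open>The lower bound\<close>

text \<open>The coefficients on the right add up to \<open>3 * N\<close>, so some \<open>g j\<close>
  is at least \<open>m / 3\<close>.\<close>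

lemma weighted_pigeonhole:
  fixes g :: "nat \<Rightarrow> real"
  assumes "0 < N" "real N * m \<le> 2 * (\<Sum>j\<in>{1..N}. g j) + real N * g N"
  shows "\<exists>j\<in>{1..N}. m / 3 \<le> g j"
proof (rule ccontr)
  assume "\<not> ?thesis"
  then have less: "g j < m / 3" if "j \<in> {1..N}" for j using that by (auto simp: not_le)
  then have "(\<Sum>j\<in>{1..N}. g j) \<le> (\<Sum>j\<in>{1..N}. m / 3)"
    by (intro sum_mono less_imp_le)
  moreover have "real N * g N < real N * (m / 3)"
    using less[of N] assms(1) by (intro mult_strict_left_mono) auto
  ultimately show False using assms(2) by simp
qed

section \<open>From losses to the competitive ratio\<close>

context adversary
begin

lemma ALG_le: "ALG A (inp j) \<le> D"
  using throughput_le_length[of "inp j"] by (simp add: ALG_def)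

text \<open>For some \<open>j\<close> the algorithm loses \<open>M / 3\<close> packets, while the
  optimum loses at most \<open>2 * m * W \<le> M / 6\<close>. The difference \<open>M / 6\<close> is
  compared with \<open>OPT \<le> D \<le> 5 * N * M\<close>, which gives the factor 30.\<close>

lemma no_algorithm_better_than_adversary:
  assumes N: "L \<le> N * N * W" "N < 2 ^ m" "12 * m \<le> N" and c: "c \<le> 1 / (30 * real N)"
  shows "no_algorithm_better_than C w L (1 - c)"
proof -
  have le_OPT: "x \<le> (1 - c) * real (OPT w (inp j))"
    if j: "j \<in> {1..N}" and x: "real M / 3 \<le> real D - x" for j x
  proof -
    have "D \<le> OPT w (inp j) + m * (2 * W)"
      using j N by (intro OPT_inp_ge) auto
    moreover have "m * (2 * W) * 6 \<le> M"
      using mult_le_mono1[OF N(3), of W] by (simp add: M_def mult_ac)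
    ultimately have "real D \<le> real (OPT w (inp j)) + real M / 6" by linarith
    moreover have "c * real (OPT w (inp j)) \<le> real M / 6"
    proof -
      have N_pos: "0 < real N" using positive by simp
      have "D \<le> 5 * (N * M)" using N(1) by (simp add: D_def Y_def F_def M_def)
      then have "OPT w (inp j) \<le> 5 * (N * M)"
        using OPT_le_length[of w "inp j"] by simp
      then have OPT_le: "real (OPT w (inp j)) \<le> 5 * (real N * real M)"
        by (metis of_nat_le_iff of_nat_mult of_nat_numeral)
      have "c * real (OPT w (inp j)) \<le> 1 / (30 * real N) * real (OPT w (inp j))"
        using c by (intro mult_right_mono) auto
      also have "\<dots> \<le> 1 / (30 * real N) * (5 * (real N * real M))"
        using OPT_le by (intro mult_left_mono) auto
      also have "\<dots> = real M / 6" using N_pos by simp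
      finally show ?thesis .
    qed
    ultimately show ?thesis using x by (simp add: left_diff_distrib)
  qed
  have loss: "real N * real M
      \<le> 2 * (\<Sum>j\<in>{1..N}. real D - real (ALG A (inp j))) + real N * (real D - real (ALG A (inp N)))"
    if "online_algorithm C w L A" for A
  proof -
    have "real (N * M)
        \<le> real (2 * (\<Sum>j\<in>{1..N}. D - ALG A (inp j)) + N * (D - ALG A (inp N)))"
      using total_loss[OF that] by (simp only: of_nat_le_iff)
    then show ?thesis by (simp add: of_nat_diff ALG_le)
  qed
  show ?thesis
    unfolding no_algorithm_better_than_def
  proof (intro conjI allI impI)
    fix A assume "online_algorithm C w L A"
    from weighted_pigeonhole[OF positive(2) loss[OF this]]
    obtain j where "j \<in> {1..N}" "real M / 3 \<le> real D - real (ALG A (inp j))" by blast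
    then show "\<exists>\<sigma>. valid_input C L \<sigma> \<and> real (ALG A \<sigma>) \<le> (1 - c) * real (OPT w \<sigma>)"
      using le_OPT valid_input_inp by (intro exI[of _ "inp j"]) auto
  next
    fix P assume P: "randomized_online_algorithm C w L P"
    then interpret prob_space P by (simp add: randomized_online_algorithm_def)
    have int: "integrable P (\<lambda>A. real (ALG A (inp j)))" if "j \<le> N" for j
      using P valid_input_inp[OF that] ALG_le
      by (intro integrable_const_bound[where B = "real D"])
         (auto simp: randomized_online_algorithm_def)
    let ?X = "\<lambda>j. expectation (\<lambda>A. real (ALG A (inp j)))"
    let ?loss = "\<lambda>A. 2 * (\<Sum>j\<in>{1..N}. real D - real (ALG A (inp j)))
      + real N * (real D - real (ALG A (inp N)))"
    have int_diff: "integrable P (\<lambda>A. real D - real (ALG A (inp j)))" if "j \<le> N" for j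
      using int[OF that] by simp
    have E_diff: "expectation (\<lambda>A. real D - real (ALG A (inp j))) = real D - ?X j" if "j \<le> N" for j
      using int[OF that] by (simp add: prob_space)
    have int_sum: "integrable P (\<lambda>A. 2 * (\<Sum>j\<in>{1..N}. real D - real (ALG A (inp j))))"
      by (intro integrable_mult_right Bochner_Integration.integrable_sum int_diff) simp
    have int_last: "integrable P (\<lambda>A. real N * (real D - real (ALG A (inp N))))"
      by (intro integrable_mult_right int_diff) simp
    \<comment> \<open>The loss inequality holds for each deterministic algorithm and is linear in
      its throughputs, so it passes to expectations. The pigeonhole then yields one input for the
      whole distribution.\<close>
    have "real N * real M \<le> expectation ?loss"
    proof (rule integral_ge_const)
      show "integrable P ?loss"
        by (rule Bochner_Integration.integrable_add[OF int_sum int_last])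
      show "AE A in P. real N * real M \<le> ?loss A"
        using P loss by (intro AE_I2) (auto simp: randomized_online_algorithm_def)
    qed
    also have "expectation ?loss
        = 2 * expectation (\<lambda>A. \<Sum>j\<in>{1..N}. real D - real (ALG A (inp j)))
          + real N * expectation (\<lambda>A. real D - real (ALG A (inp N)))"
      unfolding Bochner_Integration.integral_add[OF int_sum int_last] by simp
    also have "expectation (\<lambda>A. \<Sum>j\<in>{1..N}. real D - real (ALG A (inp j)))
        = (\<Sum>j\<in>{1..N}. real D - ?X j)"
      by (subst Bochner_Integration.integral_sum) (auto intro!: int_diff sum.cong E_diff)
    also have "expectation (\<lambda>A. real D - real (ALG A (inp N))) = real D - ?X N"
      by (rule E_diff) simp
    finally obtain j where "j \<in> {1..N}" "real M / 3 \<le> real D - ?X j"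
      using weighted_pigeonhole[OF positive(2)] by blast
    then show "\<exists>\<sigma>. valid_input C L \<sigma> \<and>
        expectation (\<lambda>A. real (ALG A \<sigma>)) \<le> (1 - c) * real (OPT w \<sigma>)"
      using le_OPT valid_input_inp by (intro exI[of _ "inp j"]) auto
  qed
qed

end

section \<open>Choice of the parameters\<close>

lemma twelve_mult_Suc_le_power: "7 \<le> q \<Longrightarrow> 12 * Suc q \<le> (2::nat) ^ q"
  by (induction q rule: nat_induct_at_least) auto

text \<open>Covers both regimes at once: the first bound on \<open>c\<close> is the stronger one for
  \<delta> above 1, the second one for \<delta> below 1.\<close>

lemma no_algorithm_better_than_metric:
  fixes w :: "nat \<Rightarrow> nat \<Rightarrow> real"
  assumes C: "2 \<le> C" and metric: "Metric_space {..<C} w" and L: "1 \<le> L"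
    and \<delta>: "\<delta> = mst_weight {..<C} w / real L" and c: "c \<le> 1 / 3000" "c \<le> 1 / 3000 * sqrt \<delta>"
  shows "no_algorithm_better_than C w L (1 - c)"
proof -
  interpret Metric_space "{..<C}" w by (fact metric)
  have "1 \<le> C" using C by simp
  then obtain root e ord where pw: "root < C" "e root = 0"
    "mst_weight {..<C} w \<le> real (\<Sum>c<C. e c)"
    "\<And>xs. set xs \<subseteq> {..<C} \<Longrightarrow> root \<in> set xs \<Longrightarrow>
      (\<Sum>c\<in>set xs. e c) \<le> path_cost (\<lambda>a b. nat \<lceil>w a b\<rceil>) xs"
    "distinct ord" "set ord = {..<C} - {root}"
    "path_cost (\<lambda>a b. nat \<lceil>w a b\<rceil>) (root # ord @ [root]) \<le> 2 * (\<Sum>c<C. e c)"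
    using prim_weights[OF _ metric] by blast
  define W where "W = (\<Sum>c<C. e c)"
  \<comment> \<open>Two colors have positive distance, so the first step of the closed tour costs at
    least one slot, and the tour costs at most \<open>2 * W\<close>.\<close>
  have "0 < W"
  proof (cases ord)
    case Nil
    then have "{..<C} \<subseteq> {root}" using pw(6) by auto
    then have "card {..<C} \<le> card {root}" by (intro card_mono) auto
    then show ?thesis using C by simp
  next
    case (Cons x xs)
    then have "x \<in> {..<C}" "x \<noteq> root" using pw(6) by auto
    then have "w root x \<noteq> 0" using pw(1) zero[of root x] by simp
    then have "0 < w root x" using le_neq_trans[OF nonneg[of root x]] by metis
    then have "0 < nat \<lceil>w root x\<rceil>" by simp
    then show ?thesis using pw(7) unfolding Cons append_Cons path_cost.simps W_def by linarith
  qed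
  \<comment> \<open>The square root makes \<open>N * N * W\<close> at least \<open>L\<close>. The
    minimum 100 gives \<open>N div 12 \<ge> 7\<close>, as needed for the number
    \<open>N div 12\<close> of tours.\<close>
  define N where "N = max 100 (nat \<lceil>sqrt (real L / real W)\<rceil>)"
  have N: "100 \<le> N" "sqrt (real L / real W) \<le> real N"
    unfolding N_def by linarith+
  interpret adv: adversary C w L N root e ord
    by unfold_locales (use pw L N(1) \<open>0 < W\<close> in \<open>simp_all add: W_def\<close>)
  have advW: "adv.W = W" by (simp add: adv.W_def W_def)
  have "real L / real W \<le> real N ^ 2"
    using N(2) by (metis real_sqrt_le_iff real_sqrt_pow2_iff real_sqrt_abs abs_of_nonneg of_nat_0_le_iff)
  then have "real L \<le> real (N * N * W)"
    using \<open>0 < W\<close> by (simp add: field_simps power2_eq_square)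
  then have "L \<le> N * N * adv.W" unfolding advW of_nat_le_iff .
  moreover have "N < 2 ^ (N div 12)"
  proof -
    have "7 \<le> N div 12" using N(1) by linarith
    then have "12 * Suc (N div 12) \<le> 2 ^ (N div 12)" by (rule twelve_mult_Suc_le_power)
    moreover have "N < 12 * Suc (N div 12)" by presburger
    ultimately show ?thesis by (rule less_le_trans[rotated])
  qed
  \<comment> \<open>For \<open>N = 100\<close> the bound is 1/3000 itself. For larger
    \<open>N\<close> rounding at most doubles \<open>sqrt (real L / real W)\<close>, so
    \<open>sqrt \<delta>\<close> is at most \<open>2 / N\<close>.\<close>
  moreover have "c \<le> 1 / (30 * real N)"
  proof (cases "N = 100")
    case True
    then show ?thesis using c(1) by simp
  next
    case False
    define s where "s = sqrt (real L / real W)"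
    have "N = nat \<lceil>s\<rceil>" "100 < N" using False unfolding N_def s_def by linarith+
    then have s: "real N \<le> 2 * s" "0 < s" by linarith+
    have "\<delta> \<le> real W / real L"
      using pw(3) L unfolding \<delta> W_def by (intro divide_right_mono) auto
    then have "sqrt \<delta> \<le> sqrt (real W / real L)" by (rule real_sqrt_le_mono)
    also have "\<dots> = 1 / s" by (simp add: s_def real_sqrt_divide)
    also have "\<dots> \<le> 2 / real N" using s \<open>100 < N\<close> by (simp add: field_simps)
    finally have "c \<le> 1 / 3000 * (2 / real N)" using c(2) by linarith
    also have "\<dots> \<le> 1 / (30 * real N)" using \<open>100 < N\<close> by (simp add: field_simps)
    finally show ?thesis .
  qed
  ultimately show ?thesis
    by (intro adv.no_algorithm_better_than_adversary[where m = "N div 12"]) auto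
qed

theorem theorem3:
  shows "\<exists>c > (0::real). \<exists>\<alpha> < (1::real).
    \<forall>(C::nat) (w :: nat \<Rightarrow> nat \<Rightarrow> real) (L::nat).
      C \<ge> 2 \<longrightarrow> Metric_space {..<C} w \<longrightarrow> L \<ge> 1 \<longrightarrow>
      (let \<delta> = mst_weight {..<C} w / real L in
        (\<delta> < 1 \<longrightarrow> no_algorithm_better_than C w L (1 - c * sqrt \<delta>)) \<and>
        (\<delta> \<ge> 1 \<longrightarrow> no_algorithm_better_than C w L \<alpha>))"
proof -
  have "no_algorithm_better_than C w L (1 - 1 / 3000 * sqrt \<delta>)"
    if "2 \<le> C" "Metric_space {..<C} w" "1 \<le> L" "\<delta> = mst_weight {..<C} w / real L" "\<delta> < 1"
    for C w L \<delta>
    using that(5) by (intro no_algorithm_better_than_metric[OF that(1-4)]) simp_all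
  moreover have "no_algorithm_better_than C w L (1 - 1 / 3000)"
    if "2 \<le> C" "Metric_space {..<C} w" "1 \<le> L" "\<delta> = mst_weight {..<C} w / real L" "1 \<le> \<delta>"
    for C w L \<delta>
    using that(5) by (intro no_algorithm_better_than_metric[OF that(1-4)]) simp_all
  ultimately show ?thesis
    by (intro exI[of _ "1 / 3000"] exI[of _ "1 - 1 / 3000"] conjI) (simp_all add: Let_def)
qed

end
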